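(* Let $\alpha \geq 1$ be a real number, and suppose there is a constant $C$ such that for every finite set $S \subset \mathbb{N}$ with $H(S) < \infty$, $$I(S) \leq \alpha \cdot H(S) + C\log_2(H(S)+2) + C.$$ Then there is a constant $C'$ such that for every set $S \subset \mathbb{N}$ (finite or infinite) with $H(S) < \infty$, $$I(S) \leq \alpha \cdot H(S) + C'\log_2(H(S)+2) + C'.$$
   Context: A deterministic enumerating machine $D$ is an algorithm that takes a finite binary string $x$ as input and, possibly running forever, outputs (enumerates) natural numbers; the set it enumerates on $x$ is the set of all numbers it ever outputs (possibly infinite). For a set $S\subset\mathbb{N}$, $I_D(S)$ is the minimum length of a binary string $x$ such that $D$ on input $x$ enumerates exactly $S$ ($I_D(S)=\infty$ if none exists). There is a universal machine $D_0$: for every $D$ there is a constant $c$ with $I_{D_0}(S) \le I_D(S)+c$ for all $S$ (note the direction: $D_0$ is at most a constant worse than any $D$). Define $I(S) = I_{D_0}(S)$ for a fixed such universal $D_0$ (well defined up to an additive constant). A probabilistic enumerating machine $M$ is an algorithm that may request arbitrarily many independent uniformly random bits and, possibly running forever, enumerates natural numbers; thus it induces a map from the Cantor space $\{0,1\}^{\mathbb{N}}$ (with the uniform measure) to subsets of $\mathbb{N}$, sending a bit sequence $w$ to the set enumerated when $w$ supplies the random bits. Define $H_M(S) = -\log_2 \Pr[M \text{ enumerates exactly } S]$ (infinite if the probability is $0$). There is an optimal machine $M_0$: for every $M$ there is a constant $c$ with $H_{M_0}(S) \le H_M(S) + c$ for all $S$. Define $H(S) = H_{M_0}(S)$ for a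 fixed such optimal $M_0$ (well defined up to an additive constant). *)

theory Defs
  imports "HOL-Probability.Probability" "HOL-Library.Nat_Bijection"
begin

datatype recf = Zero | Succ | Proj nat | Comp recf "recf list" | Prim recf recf | Mn recf

inductive eval :: "recf \<Rightarrow> nat list \<Rightarrow> nat \<Rightarrow> bool" where
  eval_Zero: "eval Zero xs 0"
| eval_Succ: "eval Succ (x # xs) (Suc x)"
| eval_Proj: "i < length xs \<Longrightarrow> eval (Proj i) xs (xs ! i)"
| eval_Comp: "list_all2 (\<lambda>f y. eval f xs y) fs ys \<Longrightarrow> eval g ys r \<Longrightarrow> eval (Comp g fs) xs r"
| eval_Prim0: "eval f xs r \<Longrightarrow> eval (Prim f g) (0 # xs) r"
| eval_PrimS: "eval (Prim f g) (n # xs) r \<Longrightarrow> eval g (r # n # xs) s \<Longrightarrow> eval (Prim f g) (Suc n # xs) s"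
| eval_Mn: "eval f (n # xs) 0 \<Longrightarrow> (\<forall>m<n. \<exists>r. eval f (m # xs) (Suc r)) \<Longrightarrow> eval (Mn f) xs n"

definition computable :: "(nat \<Rightarrow> nat) \<Rightarrow> bool" where
  "computable F \<longleftrightarrow> (\<exists>c. \<forall>x. eval c [x] (F x))"

definition enc_bits :: "bool list \<Rightarrow> nat" where
  "enc_bits xs = list_encode (map (\<lambda>b. if b then 1 else 0) xs)"

text \<open>A deterministic enumerating machine is represented by its (total, computable)
step function: E x t is the list of numbers output within t steps on input x.
The set enumerated on x is the union over all t.\<close>
definition det_machine :: "(bool list \<Rightarrow> nat \<Rightarrow> nat list) \<Rightarrow> bool" where
  "det_machine E \<longleftrightarrow> computable (\<lambda>n. list_encode (E (map (\<lambda>k. k \<noteq> 0) (list_decode (fst (prod_decode n)))) (snd (prod_decode n))))"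

definition det_enum :: "(bool list \<Rightarrow> nat \<Rightarrow> nat list) \<Rightarrow> bool list \<Rightarrow> nat set" where
  "det_enum E x = (\<Union>t. set (E x t))"

definition I_D :: "(bool list \<Rightarrow> nat \<Rightarrow> nat list) \<Rightarrow> nat set \<Rightarrow> enat" where
  "I_D E S = (INF x\<in>{x. det_enum E x = S}. enat (length x))"

definition universal_det :: "(bool list \<Rightarrow> nat \<Rightarrow> nat list) \<Rightarrow> bool" where
  "universal_det D0 \<longleftrightarrow> det_machine D0 \<and>
     (\<forall>E. det_machine E \<longrightarrow> (\<exists>c::nat. \<forall>S. I_D D0 S \<le> I_D E S + enat c))"

text \<open>A probabilistic enumerating machine is represented by a total computable map P:
P p is the list of numbers output within length p steps when the random bits requested
so far are a prefix of p (the run is cut off if it requests more bits than |p|).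
On the random sequence w it enumerates the union over n of P(first n bits of w).\<close>
definition prob_machine :: "(bool list \<Rightarrow> nat list) \<Rightarrow> bool" where
  "prob_machine P \<longleftrightarrow> computable (\<lambda>n. list_encode (P (map (\<lambda>k. k \<noteq> 0) (list_decode n))))"

definition bits_prefix :: "(nat \<Rightarrow> bool) \<Rightarrow> nat \<Rightarrow> bool list" where
  "bits_prefix w n = map w [0..<n]"

definition prob_enum :: "(bool list \<Rightarrow> nat list) \<Rightarrow> (nat \<Rightarrow> bool) \<Rightarrow> nat set" where
  "prob_enum P w = (\<Union>n. set (P (bits_prefix w n)))"

definition coin_space :: "(nat \<Rightarrow> bool) measure" where
  "coin_space = PiM UNIV (\<lambda>_. measure_pmf (bernoulli_pmf (1/2)))"

definition prob_enum_exactly :: "(bool list \<Rightarrow> nat list) \<Rightarrow> nat set \<Rightarrow> real" where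
  "prob_enum_exactly P S = measure coin_space {w. prob_enum P w = S}"

definition H_M :: "(bool list \<Rightarrow> nat list) \<Rightarrow> nat set \<Rightarrow> ereal" where
  "H_M P S = (if prob_enum_exactly P S = 0 then \<infinity> else ereal (- log 2 (prob_enum_exactly P S)))"

definition optimal_prob :: "(bool list \<Rightarrow> nat list) \<Rightarrow> bool" where
  "optimal_prob M0 \<longleftrightarrow> prob_machine M0 \<and>
     (\<forall>M. prob_machine M \<longrightarrow> (\<exists>c::real. \<forall>S. H_M M0 S \<le> H_M M S + ereal c))"

end

(* A probabilistic machine M' simulates M0, but releases the numbers enumerated by M0 only in
   blocks: whenever a finite pattern s is seen (as the part below length s of what M0 has
   enumerated so far) on a set of random sequences of measure > 2^-e that have so far been
   treated with shorter patterns only, M' enumerates exactly s on all these sequences, and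
   then stops until some program y of length <= L makes D0 have enumerated exactly s at that
   moment.  If this never happened, the finite set s would have M'-probability > 2^-e (up to the
   cost of describing e and L), and the hypothesis on finite sets would provide such a y.
   Hence M' never stops.  If M0 enumerates S with probability > 2^-e, then patterns that
   are subsets of S and agree with S on longer and longer initial segments occur infinitely
   often, as otherwise the initial segments of S would themselves become releasable.  By the
   pigeonhole principle one program y answers infinitely many of them, so D0 on y
   enumerates S, and L is a bound for I(S). *)

theory Submission
  imports Defs
begin

section \<open>Computable functions on coded data\<close>

text \<open>A pattern counts as answered by what \<open>D0\<close> has put out on \<open>y\<close>
  up to that moment, not by its final set. One program for an infinite set can therefore answer many
  finite patterns in turn; the hypothesis on finite sets is applied only to a pattern at which the
  simulation would hang. The bound \<open>L\<close> is circular: it must dominate the hypothesis at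
  a complexity that includes the cost of describing \<open>L\<close> itself to the simulator. The
  description is only logarithmic in \<open>L\<close>, so the circle closes at the price of a larger
  logarithmic term. The reason why good patterns keep coming: late enough, every pattern released on
  a sequence that enumerates \<open>S\<close> is a good one. If none came any more, those sequences
  would not be moved at all, and a long initial segment of \<open>S\<close> would stay releasable
  forever. Patterns are tried in a fixed order and each is released at most once, so only finitely
  many can be preferred to it, and a simulation that never hangs cannot postpone it forever.\<close>

definition recfn :: "nat \<Rightarrow> (nat list \<Rightarrow> nat) \<Rightarrow> bool" where
  "recfn k F \<longleftrightarrow> (\<exists>c. \<forall>xs. length xs = k \<longrightarrow> eval c xs (F xs))"

lemma recfn_proj: "i < k \<Longrightarrow> recfn k (\<lambda>xs. xs ! i)"
  unfolding recfn_def by (metis eval_Proj)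

lemma recfn_comp1:
  assumes "recfn 1 (\<lambda>xs. f (xs ! 0))" "recfn k g"
  shows "recfn k (\<lambda>xs. f (g xs))"
proof -
  obtain c where "\<And>xs. length xs = 1 \<Longrightarrow> eval c xs (f (xs ! 0))"
    using assms unfolding recfn_def by blast
  from this[of "[x]" for x] have "\<And>x. eval c [x] (f x)" by simp
  moreover obtain d where "\<And>xs. length xs = k \<Longrightarrow> eval d xs (g xs)"
    using assms unfolding recfn_def by blast
  ultimately have "length xs = k \<Longrightarrow> eval (Comp c [d]) xs (f (g xs))" for xs
    by (intro eval_Comp[where ys = "[g xs]"]) auto
  then show ?thesis unfolding recfn_def by blast
qed

lemma recfn_Suc: "recfn k g \<Longrightarrow> recfn k (\<lambda>xs. Suc (g xs))"
proof (rule recfn_comp1[where f = Suc])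
  have "eval Succ xs (Suc (xs ! 0))" if "length xs = 1" for xs
    using that eval_Succ[of "xs ! 0" "tl xs"] by (cases xs) auto
  then show "recfn 1 (\<lambda>xs. Suc (xs ! 0))" unfolding recfn_def by blast
qed

lemma recfn_const: "recfn k (\<lambda>xs. n)"
proof (induction n)
  case 0
  show ?case unfolding recfn_def by (metis eval_Zero)
qed (rule recfn_Suc)

text \<open>\<open>Prim\<close> recurses on the first entry of its argument list, so
  \<open>Comp\<close> first puts \<open>h xs\<close> in front of copies of all entries; the depth
  may then be any computable value while the step still sees the whole of \<open>xs\<close>.\<close>

lemma recfn_rec:
  assumes a: "recfn k a" and g: "recfn (Suc (Suc k)) (\<lambda>xs. g (xs ! 0) (xs ! 1) (drop 2 xs))"
    and h: "recfn k h"
  shows "recfn k (\<lambda>xs. rec_nat (a xs) (\<lambda>n r. g r n xs) (h xs))"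
proof -
  obtain ca where ca: "\<And>xs. length xs = k \<Longrightarrow> eval ca xs (a xs)"
    using a unfolding recfn_def by blast
  obtain ch where ch: "\<And>xs. length xs = k \<Longrightarrow> eval ch xs (h xs)"
    using h unfolding recfn_def by blast
  obtain cg where "\<And>xs. length xs = Suc (Suc k) \<Longrightarrow> eval cg xs (g (xs ! 0) (xs ! 1) (drop 2 xs))"
    using g unfolding recfn_def by blast
  from this[of "r # n # xs" for r n xs]
  have cg: "eval cg (r # n # xs) (g r n xs)" if "length xs = k" for r n xs
    using that by simp
  have prim: "eval (Prim ca cg) (n # xs) (rec_nat (a xs) (\<lambda>n r. g r n xs) n)"
    if "length xs = k" for n xs
  proof (induction n)
    case 0
    then show ?case using ca[OF that] by (simp add: eval_Prim0)
  next
    case (Suc n)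
    then show ?case using eval_PrimS[OF Suc cg[OF that]] by simp
  qed
  have "list_all2 (\<lambda>f y. eval f xs y) (ch # map Proj [0..<k]) (h xs # xs)"
    if "length xs = k" for xs
    using that ch[OF that] by (auto simp: list_all2_conv_all_nth nth_Cons intro: eval_Proj split: nat.split)
  then have "eval (Comp (Prim ca cg) (ch # map Proj [0..<k])) xs
      (rec_nat (a xs) (\<lambda>n r. g r n xs) (h xs))" if "length xs = k" for xs
    using eval_Comp prim that by blast
  then show ?thesis unfolding recfn_def by blast
qed

lemma recfn_add: "recfn k f \<Longrightarrow> recfn k g \<Longrightarrow> recfn k (\<lambda>xs. f xs + g xs)"
proof -
  have [simp]: "rec_nat y (\<lambda>n r. Suc r) x = x + y" for x y by (induction x) auto
  show "recfn k f \<Longrightarrow> recfn k g \<Longrightarrow> recfn k (\<lambda>xs. f xs + g xs)"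
    using recfn_rec[of k g "\<lambda>r n xs. Suc r" f] by (simp add: recfn_Suc recfn_proj)
qed

lemma recfn_diff: "recfn k f \<Longrightarrow> recfn k g \<Longrightarrow> recfn k (\<lambda>xs. f xs - g xs)"
proof -
  have p: "recfn k f \<Longrightarrow> recfn k (\<lambda>xs. f xs - 1)" for k f
  proof -
    have [simp]: "rec_nat 0 (\<lambda>n r. n) x = x - 1" for x by (cases x) auto
    show "recfn k f \<Longrightarrow> recfn k (\<lambda>xs. f xs - 1)"
      using recfn_rec[of k "\<lambda>xs. 0" "\<lambda>r n xs. n" f] by (simp add: recfn_const recfn_proj)
  qed
  have [simp]: "rec_nat x (\<lambda>n r. r - Suc 0) y = x - y" for x y :: nat by (induction y) auto
  show "recfn k f \<Longrightarrow> recfn k g \<Longrightarrow> recfn k (\<lambda>xs. f xs - g xs)"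
    using recfn_rec[of k f "\<lambda>r n xs. r - 1" g] p[OF recfn_proj] by simp
qed

text \<open>Truncated subtraction turns the comparison into a test for zero, and a recursion whose
  step ignores the previous value acts as a branch.\<close>

lemma recfn_if_le:
  assumes "recfn k f" "recfn k g" "recfn k a" "recfn k b"
  shows "recfn k (\<lambda>xs. if f xs \<le> g xs then a xs else b xs)"
proof -
  have *: "rec_nat x (\<lambda>n r. y) z = (if z = 0 then x else y)" for x y z :: nat by (cases z) auto
  \<comment> \<open>In a recursion step the previous value and the counter precede the arguments of
    \<open>b\<close>, so the projections are shifted by two.\<close>
  have "recfn (Suc (Suc k)) (\<lambda>xs. b (drop 2 xs))"
  proof -
    obtain c where c: "\<And>xs. length xs = k \<Longrightarrow> eval c xs (b xs)"
      using assms(4) unfolding recfn_def by blast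
    have "list_all2 (\<lambda>f y. eval f xs y) (map Proj [2..<Suc (Suc k)]) (drop 2 xs)"
      if "length xs = Suc (Suc k)" for xs
      using that eval_Proj[of "2 + i" xs for i]
      by (auto simp: list_all2_conv_all_nth simp del: upt_Suc)
    then have "eval (Comp c (map Proj [2..<Suc (Suc k)])) xs (b (drop 2 xs))"
      if "length xs = Suc (Suc k)" for xs
      using that by (intro eval_Comp[OF _ c]) auto
    then show ?thesis unfolding recfn_def by blast
  qed
  then show ?thesis
    using recfn_rec[of k a "\<lambda>r n xs. b xs" "\<lambda>xs. f xs - g xs"] assms recfn_diff
    by (simp add: *)
qed

section \<open>The Cantor pairing function and its inverse\<close>

lemma recfn_triangle: "recfn k f \<Longrightarrow> recfn k (\<lambda>xs. triangle (f xs))"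
proof -
  have [simp]: "rec_nat 0 (\<lambda>n r. Suc (r + n)) x = triangle x" for x by (induction x) auto
  show "recfn k f \<Longrightarrow> recfn k (\<lambda>xs. triangle (f xs))"
    using recfn_rec[of k "\<lambda>xs. 0" "\<lambda>r n xs. r + Suc n" f]
      recfn_add[OF recfn_proj recfn_Suc[OF recfn_proj], of 0 "Suc (Suc k)" 1]
    by (simp add: recfn_const)
qed

lemma recfn_prod_encode:
  "recfn k f \<Longrightarrow> recfn k g \<Longrightarrow> recfn k (\<lambda>xs. prod_encode (f xs, g xs))"
  unfolding prod_encode_def by (simp add: recfn_add recfn_triangle)

text \<open>The largest r with \<open>triangle r \<le> n\<close>. On the code of (a, b) it is a + b,
  from which both components follow by subtraction; counting up along n makes it primitive
  recursive.\<close>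

primrec triangle_root :: "nat \<Rightarrow> nat" where
  "triangle_root 0 = 0"
| "triangle_root (Suc n) =
    (if triangle (Suc (triangle_root n)) \<le> Suc n then Suc (triangle_root n) else triangle_root n)"

lemma triangle_root_bounds:
  "triangle (triangle_root z) \<le> z \<and> z < triangle (Suc (triangle_root z))"
proof (induction z)
  case (Suc z)
  then show ?case
    by auto
qed simp

lemma triangle_mono: "a \<le> b \<Longrightarrow> triangle a \<le> triangle b"
  by (induction rule: dec_induct) auto

lemma prod_decode_triangle_root:
  "fst (prod_decode z) = z - triangle (triangle_root z)"
  "snd (prod_decode z) = triangle_root z - (z - triangle (triangle_root z))"
proof -
  obtain a b where ab: "prod_decode z = (a, b)" by fastforce
  then have z: "z = triangle (a + b) + a"
    using prod_decode_inverse[of z] by (simp add: prod_encode_def)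
  have "triangle_root z = a + b"
  proof (cases "triangle_root z" "a + b" rule: linorder_cases)
    case less
    then show ?thesis
      using triangle_root_bounds[of z] triangle_mono[of "Suc (triangle_root z)" "a + b"] z by linarith
  next
    case greater
    then show ?thesis
      using triangle_root_bounds[of z] triangle_mono[of "Suc (a + b)" "triangle_root z"] z
      unfolding triangle_Suc by linarith
  qed
  then show "fst (prod_decode z) = z - triangle (triangle_root z)"
     "snd (prod_decode z) = triangle_root z - (z - triangle (triangle_root z))"
    using ab z by simp_all
qed

lemma recfn_prod_decode:
  assumes "recfn k f"
  shows "recfn k (\<lambda>xs. fst (prod_decode (f xs)))" "recfn k (\<lambda>xs. snd (prod_decode (f xs)))"
proof -
  have "recfn (Suc (Suc k)) (\<lambda>xs. if triangle (Suc (xs ! 0)) \<le> Suc (xs ! 1) then Suc (xs ! 0) else xs ! 0)"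
    by (intro recfn_if_le recfn_triangle recfn_Suc recfn_proj) auto
  moreover have "rec_nat 0 (\<lambda>n r. if triangle (Suc r) \<le> Suc n then Suc r else r) z = triangle_root z"
    for z by (induction z) (simp_all only: nat.rec triangle_root.simps)
  ultimately have "recfn k (\<lambda>xs. triangle_root (f xs))"
    using recfn_rec[of k "\<lambda>xs. 0" "\<lambda>r n xs. if triangle (Suc r) \<le> Suc n then Suc r else r" f] assms
    by (simp only: recfn_const)
  then show "recfn k (\<lambda>xs. fst (prod_decode (f xs)))" "recfn k (\<lambda>xs. snd (prod_decode (f xs)))"
    unfolding prod_decode_triangle_root by (intro recfn_diff recfn_triangle assms; assumption)+
qed

lemma computable_iff_recfn: "computable F \<longleftrightarrow> recfn 1 (\<lambda>xs. F (xs ! 0))"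
proof -
  have "(\<forall>x. eval c [x] (F x)) \<longleftrightarrow> (\<forall>xs. length xs = 1 \<longrightarrow> eval c xs (F (xs ! 0)))" for c
    by (auto simp: length_Suc_conv)
  then show ?thesis unfolding computable_def recfn_def by simp
qed

section \<open>Computable maps between types with injective codes\<close>

class codable =
  fixes enc :: "'a \<Rightarrow> nat"
  assumes enc_eq_iff [simp]: "enc x = enc y \<longleftrightarrow> x = y"

instantiation nat :: codable begin
definition enc_nat :: "nat \<Rightarrow> nat" where [simp]: "enc_nat n = n"
instance by standard simp
end

instantiation bool :: codable begin
definition enc_bool :: "bool \<Rightarrow> nat" where "enc_bool b = (if b then 1 else 0)"
instance by standard (auto simp: enc_bool_def)
end

instantiation prod :: (codable, codable) codable begin
definition enc_prod :: "'a \<times> 'b \<Rightarrow> nat" where "enc_prod p = prod_encode (enc (fst p), enc (snd p))"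
instance
proof
  show "enc p = enc q \<longleftrightarrow> p = q" for p q :: "'a \<times> 'b"
    by (cases p; cases q) (simp add: enc_prod_def)
qed
end

instantiation list :: (codable) codable begin
definition enc_list :: "'a list \<Rightarrow> nat" where "enc_list xs = list_encode (map enc xs)"
instance
proof
  have "inj (enc :: 'a \<Rightarrow> nat)" by (rule injI) simp
  then show "enc xs = enc ys \<longleftrightarrow> xs = ys" for xs ys :: "'a list"
    by (simp add: enc_list_def list_encode_eq inj_map_eq_map)
qed
end

text \<open>Only the values on codes matter, since not every number is a code.\<close>

definition cpt :: "('a::codable \<Rightarrow> 'b::codable) \<Rightarrow> bool" where
  "cpt f \<longleftrightarrow> (\<exists>F. recfn 1 (\<lambda>xs. F (xs ! 0)) \<and> (\<forall>x. F (enc x) = enc (f x)))"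

named_theorems cpt_intros

lemma cptI: "recfn 1 (\<lambda>xs. F (xs ! 0)) \<Longrightarrow> (\<And>x. F (enc x) = enc (f x)) \<Longrightarrow> cpt f"
  unfolding cpt_def by blast

lemma cpt_comp: "cpt f \<Longrightarrow> cpt g \<Longrightarrow> cpt (\<lambda>x. f (g x))"
proof -
  assume "cpt f" "cpt g"
  then obtain F G where "recfn 1 (\<lambda>xs. F (xs ! 0))" "\<And>x. F (enc x) = enc (f x)"
    "recfn 1 (\<lambda>xs. G (xs ! 0))" "\<And>x. G (enc x) = enc (g x)" unfolding cpt_def by blast
  then show ?thesis
    by - (rule cptI[where F = "\<lambda>n. F (G n)"], rule recfn_comp1[of F "1" "\<lambda>xs. G (xs ! 0)"], simp_all)
qed

lemma cpt_id [cpt_intros]: "cpt (\<lambda>x. x)"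
  by (rule cptI[where F = "\<lambda>n. n"]) (simp_all add: recfn_proj)

lemma cpt_const [cpt_intros]: "cpt (\<lambda>x. c)"
  by (rule cptI[where F = "\<lambda>n. enc c"]) (simp_all add: recfn_const)

lemma cpt_Pair [cpt_intros]: "cpt f \<Longrightarrow> cpt g \<Longrightarrow> cpt (\<lambda>x. (f x, g x))"
proof -
  assume "cpt f" "cpt g"
  then obtain F G where "recfn 1 (\<lambda>xs. F (xs ! 0))" "\<And>x. F (enc x) = enc (f x)"
    "recfn 1 (\<lambda>xs. G (xs ! 0))" "\<And>x. G (enc x) = enc (g x)" unfolding cpt_def by blast
  then show ?thesis
    by (intro cptI[where F = "\<lambda>n. prod_encode (F n, G n)"])
      (simp_all add: recfn_prod_encode enc_prod_def)
qed

lemma cpt_fst [cpt_intros]: "cpt f \<Longrightarrow> cpt (\<lambda>x. fst (f x))"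
  by (rule cpt_comp[where f = fst], rule cptI[where F = "\<lambda>n. fst (prod_decode n)"])
     (simp_all add: enc_prod_def recfn_prod_decode recfn_proj)

lemma cpt_snd [cpt_intros]: "cpt f \<Longrightarrow> cpt (\<lambda>x. snd (f x))"
  by (rule cpt_comp[where f = snd], rule cptI[where F = "\<lambda>n. snd (prod_decode n)"])
     (simp_all add: enc_prod_def recfn_prod_decode recfn_proj)

lemma cpt_Suc [cpt_intros]: "cpt f \<Longrightarrow> cpt (\<lambda>x. Suc (f x))"
  by (rule cpt_comp[where f = Suc], rule cptI[where F = Suc])
     (simp_all add: recfn_Suc recfn_proj)

lemma cpt_comp2: "cpt (\<lambda>p. f (fst p) (snd p)) \<Longrightarrow> cpt g \<Longrightarrow> cpt h \<Longrightarrow> cpt (\<lambda>x. f (g x) (h x))"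
  using cpt_comp[of "\<lambda>p. f (fst p) (snd p)" "\<lambda>x. (g x, h x)"] by (simp add: cpt_Pair)

lemma cpt_comp3:
  "cpt (\<lambda>p. f (fst p) (fst (snd p)) (snd (snd p))) \<Longrightarrow> cpt a \<Longrightarrow> cpt b \<Longrightarrow> cpt c
    \<Longrightarrow> cpt (\<lambda>x. f (a x) (b x) (c x))"
  using cpt_comp[of "\<lambda>p. f (fst p) (fst (snd p)) (snd (snd p))" "\<lambda>x. (a x, b x, c x)"]
  by (simp add: cpt_Pair)

lemma cpt_rec_nat [cpt_intros]:
  assumes a: "cpt a" and g: "cpt (\<lambda>p. g (fst p) (fst (snd p)) (snd (snd p)))" and h: "cpt h"
  shows "cpt (\<lambda>x. rec_nat (a x) (\<lambda>n r. g x n r) (h x))"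
proof -
  obtain A G H where A: "recfn 1 (\<lambda>xs. A (xs ! 0))" "\<And>x. A (enc x) = enc (a x)"
    and G: "recfn 1 (\<lambda>xs. G (xs ! 0))"
      "\<And>p. G (enc p) = enc (g (fst p) (fst (snd p)) (snd (snd p)))"
    and H: "recfn 1 (\<lambda>xs. H (xs ! 0))" "\<And>x. H (enc x) = h x"
    using assms unfolding cpt_def by auto
  let ?F = "\<lambda>m. rec_nat (A m) (\<lambda>n r. G (prod_encode (m, prod_encode (n, r)))) (H m)"
  have "recfn (Suc (Suc 1)) (\<lambda>xs. G (prod_encode (drop 2 xs ! 0, prod_encode (xs ! 1, xs ! 0))))"
  proof (intro recfn_comp1[OF G(1)] recfn_prod_encode recfn_proj)
    have "recfn (Suc (Suc 1)) (\<lambda>xs. xs ! 2)" by (simp add: recfn_proj)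
    moreover have "length xs = Suc (Suc 1) \<Longrightarrow> drop 2 xs ! 0 = xs ! 2" for xs :: "nat list" by simp
    ultimately show "recfn (Suc (Suc 1)) (\<lambda>xs. drop 2 xs ! 0)"
      unfolding recfn_def by metis
  qed auto
  then have "recfn 1 (\<lambda>xs. ?F (xs ! 0))"
    by (intro recfn_rec A H)
  moreover have "rec_nat (enc (a x)) (\<lambda>n r. G (prod_encode (enc x, prod_encode (n, r)))) k
    = enc (rec_nat (a x) (\<lambda>n r. g x n r) k)" for x k
    by (induction k) (simp_all add: G(2)[of "(x, n, r)" for x n r, unfolded enc_prod_def, simplified])
  ultimately show ?thesis by (intro cptI[where F = ?F]) (simp_all add: A H)
qed

lemma cpt_add [cpt_intros]: "cpt f \<Longrightarrow> cpt g \<Longrightarrow> cpt (\<lambda>x. f x + (g x :: nat))"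
  by (rule cpt_comp2[where f = "(+)"], rule cptI[where F = "\<lambda>n. fst (prod_decode n) + snd (prod_decode n)"])
    (simp_all add: enc_prod_def recfn_add recfn_prod_decode recfn_proj)

lemma cpt_diff [cpt_intros]: "cpt f \<Longrightarrow> cpt g \<Longrightarrow> cpt (\<lambda>x. f x - (g x :: nat))"
  by (rule cpt_comp2[where f = "(-)"], rule cptI[where F = "\<lambda>n. fst (prod_decode n) - snd (prod_decode n)"])
    (simp_all add: enc_prod_def recfn_diff recfn_prod_decode recfn_proj)

lemma cpt_mult [cpt_intros]: "cpt f \<Longrightarrow> cpt g \<Longrightarrow> cpt (\<lambda>x. f x * (g x :: nat))"
proof -
  have [simp]: "rec_nat 0 (\<lambda>_ r. r + b) a = a * b" for a b :: nat by (induction a) auto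
  have "cpt (\<lambda>p. rec_nat 0 (\<lambda>_ r. r + snd p) (fst p) :: nat)" by (intro cpt_intros)
  then show "cpt f \<Longrightarrow> cpt g \<Longrightarrow> cpt (\<lambda>x. f x * (g x :: nat))"
    by - (rule cpt_comp2[where f = "(*)"], simp_all)
qed

lemma cpt_power2 [cpt_intros]: "cpt f \<Longrightarrow> cpt (\<lambda>x. 2 ^ f x :: nat)"
proof -
  have "rec_nat 1 (\<lambda>_ r. r + r) a = (2::nat) ^ a" for a by (induction a) auto
  then have [simp]: "rec_nat (Suc 0) (\<lambda>_ r. r + r) = (\<lambda>a. (2::nat) ^ a)" by auto
  have "cpt (\<lambda>p. rec_nat 1 (\<lambda>_ r. r + r) p :: nat)" by (intro cpt_intros)
  then show "cpt f \<Longrightarrow> cpt (\<lambda>x. 2 ^ f x :: nat)"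
    by - (rule cpt_comp[where f = "(^) 2"], simp_all)
qed

text \<open>A code is itself a number, so it can be used as a numerical value, for example as the
  depth of a recursion or in a comparison.\<close>

lemma cpt_nat_code: "cpt (\<lambda>x. enc (f x)) \<longleftrightarrow> cpt f"
  unfolding cpt_def by simp

lemma cpt_le [cpt_intros]:
  "cpt f \<Longrightarrow> cpt g \<Longrightarrow> cpt (\<lambda>x. f x \<le> (g x :: nat))"
proof (rule cpt_comp2[where f = "(\<le>)"])
  have "recfn 1 (\<lambda>xs. if fst (prod_decode (xs ! 0)) \<le> snd (prod_decode (xs ! 0)) then 1 else 0)"
    by (intro recfn_if_le recfn_prod_decode recfn_proj recfn_const) auto
  then show "cpt (\<lambda>p. fst p \<le> (snd p :: nat))"
    by (intro cptI[where F = "\<lambda>n. if fst (prod_decode n) \<le> snd (prod_decode n) then 1 else 0"])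
      (simp_all add: enc_prod_def enc_bool_def)
qed

text \<open>A Boolean has code 0 or 1: recursion to that depth either keeps the initial value or
  overwrites it once.\<close>

lemma cpt_if [cpt_intros]:
  assumes "cpt b" "cpt f" "cpt g"
  shows "cpt (\<lambda>x. if b x then f x else g x)"
proof -
  have "rec_nat (g x) (\<lambda>_ _. f x) (enc (b x)) = (if b x then f x else g x)" for x
    by (simp add: enc_bool_def)
  moreover have "cpt (\<lambda>x. rec_nat (g x) (\<lambda>_ _. f x) (enc (b x)))"
    using assms by (intro cpt_intros cpt_comp[OF assms(2)]) (simp_all add: cpt_nat_code)
  ultimately show ?thesis by simp
qed

lemma cpt_not [cpt_intros]: "cpt b \<Longrightarrow> cpt (\<lambda>x. \<not> b x)"
proof -
  have "(\<lambda>x. \<not> b x) = (\<lambda>x. if b x then False else True)" by auto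
  then show "cpt b \<Longrightarrow> cpt (\<lambda>x. \<not> b x)" by (simp only:) (intro cpt_if cpt_const)
qed

lemma cpt_conj [cpt_intros]: "cpt b \<Longrightarrow> cpt c \<Longrightarrow> cpt (\<lambda>x. b x \<and> c x)"
proof -
  have "(\<lambda>x. b x \<and> c x) = (\<lambda>x. if b x then c x else False)" by auto
  then show "cpt b \<Longrightarrow> cpt c \<Longrightarrow> cpt (\<lambda>x. b x \<and> c x)"
    by (simp only:) (intro cpt_if cpt_const)
qed

text \<open>Injectivity of \<open>enc\<close> reduces equality at any type to two comparisons of
  numbers.\<close>

lemma cpt_eq [cpt_intros]: "cpt f \<Longrightarrow> cpt g \<Longrightarrow> cpt (\<lambda>x. f x = g x)"
proof -
  have *: "x = y \<longleftrightarrow> enc x \<le> enc y \<and> enc y \<le> enc x" for x y :: 'b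
    using enc_eq_iff[of x y] by auto
  show "cpt f \<Longrightarrow> cpt g \<Longrightarrow> cpt (\<lambda>x. f x = g x)"
    unfolding * by (intro cpt_intros) (simp_all add: cpt_nat_code)
qed

lemma cpt_less [cpt_intros]: "cpt f \<Longrightarrow> cpt g \<Longrightarrow> cpt (\<lambda>x. f x < (g x :: nat))"
  using cpt_le[of "\<lambda>x. Suc (f x)" g] by (simp add: cpt_Suc Suc_le_eq)

section \<open>Computable operations on lists\<close>

lemma enc_Nil [simp]: "enc [] = 0"
  by (simp add: enc_list_def)

lemma enc_Cons: "enc (x # xs) = Suc (prod_encode (enc x, enc xs))"
  by (simp add: enc_list_def)

lemma cpt_Cons [cpt_intros]: "cpt f \<Longrightarrow> cpt g \<Longrightarrow> cpt (\<lambda>x. f x # g x)"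
  by (rule cpt_comp2[where f = "(#)"], rule cptI[where F = Suc])
    (simp_all add: enc_Cons enc_prod_def recfn_Suc recfn_proj)

lemma cpt_tl [cpt_intros]: "cpt f \<Longrightarrow> cpt (\<lambda>x. tl (f x))"
proof (rule cpt_comp[where f = tl])
  show "cpt (tl :: 'b list \<Rightarrow> _)"
  proof (rule cptI[where F = "\<lambda>n. snd (prod_decode (n - 1))"])
    show "snd (prod_decode (enc xs - 1)) = enc (tl xs)" for xs :: "'b list"
    proof (cases xs)
      case Nil
      \<comment> \<open>The truncated difference \<open>0 - 1\<close> decodes to a pair of zeros, so
        the code of the empty list is sent to itself without a case distinction.\<close>
      have "prod_decode 0 = (0, 0)" by (simp add: prod_decode_def prod_decode_aux.simps)
      then show ?thesis using Nil by simp
    qed (simp add: enc_Cons)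
  qed (intro recfn_prod_decode recfn_diff recfn_proj recfn_const, simp)
qed

lemma cpt_hd_default: "cpt f \<Longrightarrow> cpt (\<lambda>x. if f x = [] then c else hd (f x))"
proof (rule cpt_comp[where f = "\<lambda>xs. if xs = [] then c else hd xs"])
  show "cpt (\<lambda>xs. if xs = [] then c else hd xs)"
  proof (rule cptI[where F = "\<lambda>n. if n \<le> 0 then enc c else fst (prod_decode (n - 1))"])
    show "(if enc xs \<le> 0 then enc c else fst (prod_decode (enc xs - 1)))
        = enc (if xs = [] then c else hd xs)" for xs
      by (cases xs) (auto simp: enc_Cons)
  qed (intro recfn_prod_decode recfn_diff recfn_proj recfn_const recfn_if_le, simp_all)
qed

lemma cpt_case_list [cpt_intros]:
  assumes "cpt a" "cpt (\<lambda>p. g (fst p) (fst (snd p)) (snd (snd p)))" "cpt f"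
  shows "cpt (\<lambda>x. case f x of [] \<Rightarrow> a x | y # ys \<Rightarrow> g x y ys)"
proof -
  \<comment> \<open>\<open>undefined\<close> is an arbitrary constant and as such computable; the
    branch for the empty list never looks at it.\<close>
  let ?h = "\<lambda>x. g x (if f x = [] then undefined else hd (f x)) (tl (f x))"
  have "(\<lambda>x. case f x of [] \<Rightarrow> a x | y # ys \<Rightarrow> g x y ys) = (\<lambda>x. if f x = [] then a x else ?h x)"
    by (rule ext) (simp split: list.split)
  moreover have "cpt ?h"
    by (rule cpt_comp3[OF assms(2)]) (rule cpt_id cpt_hd_default cpt_tl assms)+
  ultimately show ?thesis
    by (simp only:) (rule cpt_if[OF cpt_eq[OF assms(3) cpt_const] assms(1)])
qed

lemma length_le_enc: "length xs \<le> enc xs"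
  by (induction xs) (auto simp: enc_Cons intro: order_trans[OF _ le_prod_encode_2])

text \<open>The code of a list bounds its length, so it can serve as the depth of a recursion that
  consumes one entry per round; surplus rounds change nothing.\<close>

lemma cpt_fold [cpt_intros]:
  assumes g: "cpt (\<lambda>p. g (fst p) (fst (snd p)) (snd (snd p)))" and f: "cpt f" and a: "cpt a"
  shows "cpt (\<lambda>x. fold (\<lambda>y r. g x y r) (f x) (a x))"
proof -
  define step where "step x n s = (case fst s of [] \<Rightarrow> ([], snd s) | y # ys \<Rightarrow> (ys, g x y (snd s)))"
    for x and n :: nat and s
  have run: "rec_nat (ys, r) (step x) n = (drop n ys, fold (g x) (take n ys) r)" for x ys r n
  proof (induction n)
    case (Suc n)
    show ?case
    proof (cases "n < length ys")
      case True
      then have "drop n ys = ys ! n # drop (Suc n) ys" by (simp add: Cons_nth_drop_Suc)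
      then show ?thesis using Suc True by (simp add: step_def take_Suc_conv_app_nth)
    qed (use Suc in \<open>simp add: step_def\<close>)
  qed simp
  have "fold (\<lambda>y r. g x y r) (f x) (a x) = snd (rec_nat (f x, a x) (step x) (enc (f x)))" for x
    by (simp add: run length_le_enc)
  moreover have "cpt (\<lambda>q. step (fst q) (fst (snd q)) (snd (snd q)))"
    unfolding step_def by (intro cpt_intros cpt_comp3[OF g])
  then have "cpt (\<lambda>x. snd (rec_nat (f x, a x) (\<lambda>n s. step x n s) (enc (f x))))"
    by (intro cpt_snd cpt_rec_nat cpt_Pair f a) (simp_all add: cpt_nat_code f)
  ultimately show ?thesis by simp
qed

lemma cpt_rev [cpt_intros]: "cpt f \<Longrightarrow> cpt (\<lambda>x. rev (f x))"
proof -
  assume "cpt f"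
  then have "cpt (\<lambda>x. fold (\<lambda>y r. y # r) (f x) [])" by (intro cpt_intros)
  then show ?thesis by (simp add: rev_conv_fold)
qed

lemma cpt_foldr [cpt_intros]:
  assumes g: "cpt (\<lambda>p. g (fst p) (fst (snd p)) (snd (snd p)))" and "cpt f" "cpt a"
  shows "cpt (\<lambda>x. foldr (\<lambda>y r. g x y r) (f x) (a x))"
  unfolding foldr_conv_fold by (intro cpt_intros assms)

lemma cpt_map [cpt_intros]:
  assumes "cpt (\<lambda>p. g (fst p) (snd p))" "cpt f"
  shows "cpt (\<lambda>x. map (\<lambda>y. g x y) (f x))"
proof -
  have "cpt (\<lambda>x. foldr (\<lambda>y r. g x y # r) (f x) [])"
    by (intro cpt_intros assms(2) cpt_comp2[OF assms(1)])
  moreover have "foldr (\<lambda>y r. g x y # r) ys [] = map (g x) ys" for x ys by (induction ys) auto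
  ultimately show ?thesis by simp
qed

lemma cpt_filter [cpt_intros]:
  assumes "cpt (\<lambda>p. g (fst p) (snd p))" "cpt f"
  shows "cpt (\<lambda>x. filter (\<lambda>y. g x y) (f x))"
proof -
  have "cpt (\<lambda>x. foldr (\<lambda>y r. if g x y then y # r else r) (f x) [])"
    by (intro cpt_intros assms(2) cpt_comp2[OF assms(1)])
  moreover have "foldr (\<lambda>y r. if g x y then y # r else r) ys [] = filter (g x) ys" for x ys
    by (induction ys) auto
  ultimately show ?thesis by simp
qed

lemma cpt_list_ex [cpt_intros]:
  assumes "cpt (\<lambda>p. g (fst p) (snd p))" "cpt f"
  shows "cpt (\<lambda>x. \<exists>y\<in>set (f x). g x y)"
  using cpt_not[OF cpt_eq[OF cpt_filter[OF assms] cpt_const[of "[]"]]] by (simp add: filter_empty_conv)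

lemma cpt_list_all [cpt_intros]:
  assumes "cpt (\<lambda>p. g (fst p) (snd p))" "cpt f"
  shows "cpt (\<lambda>x. \<forall>y\<in>set (f x). g x y)"
  using cpt_eq[OF cpt_filter[OF cpt_not[OF assms(1)] assms(2)] cpt_const[of "[]"]]
  by (simp add: filter_empty_conv)

lemma cpt_in_set [cpt_intros]: "cpt f \<Longrightarrow> cpt g \<Longrightarrow> cpt (\<lambda>x. f x \<in> set (g x))"
  using cpt_list_ex[of "\<lambda>x y. f x = y" g] by (simp add: cpt_eq cpt_comp[of f] cpt_fst cpt_snd cpt_id)

lemma cpt_set_eq [cpt_intros]: "cpt f \<Longrightarrow> cpt g \<Longrightarrow> cpt (\<lambda>x. set (f x) = set (g x))"
proof -
  have *: "set xs = set ys \<longleftrightarrow> (\<forall>x\<in>set xs. x \<in> set ys) \<and> (\<forall>y\<in>set ys. y \<in> set xs)" for xs ys :: "'b list"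
    by blast
  assume f: "cpt f" and g: "cpt g"
  show ?thesis unfolding * by (intro cpt_intros cpt_comp[OF f] cpt_comp[OF g] f g)
qed

lemma cpt_length [cpt_intros]: "cpt f \<Longrightarrow> cpt (\<lambda>x. length (f x))"
proof -
  assume "cpt f"
  then have "cpt (\<lambda>x. foldr (\<lambda>_ r. Suc r) (f x) 0)" by (intro cpt_intros)
  moreover have "foldr (\<lambda>_ r. Suc r) ys 0 = length ys" for ys :: "'b list" by (induction ys) auto
  ultimately show ?thesis by simp
qed

lemma cpt_append [cpt_intros]: "cpt f \<Longrightarrow> cpt g \<Longrightarrow> cpt (\<lambda>x. f x @ g x)"
proof -
  assume "cpt f" "cpt g"
  then have "cpt (\<lambda>x. foldr (\<lambda>y r. y # r) (f x) (g x))" by (intro cpt_intros)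
  moreover have "foldr (\<lambda>y r. y # r) xs ys = xs @ ys" for xs ys :: "'b list" by (induction xs) auto
  ultimately show ?thesis by simp
qed

lemma cpt_concat [cpt_intros]: "cpt f \<Longrightarrow> cpt (\<lambda>x. concat (f x))"
  unfolding concat_conv_foldr by (intro cpt_intros cpt_comp2[of append])

lemma cpt_upt [cpt_intros]: "cpt f \<Longrightarrow> cpt (\<lambda>x. [0..<f x])"
proof -
  assume "cpt f"
  then have "cpt (\<lambda>x. rec_nat [] (\<lambda>n r. r @ [n]) (f x))" by (intro cpt_intros)
  moreover have "rec_nat [] (\<lambda>n r. r @ [n]) k = [0..<k]" for k by (induction k) auto
  ultimately show ?thesis by simp
qed

lemma cpt_drop [cpt_intros]: "cpt f \<Longrightarrow> cpt g \<Longrightarrow> cpt (\<lambda>x. drop (f x) (g x))"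
proof -
  assume "cpt f" "cpt g"
  then have "cpt (\<lambda>x. rec_nat (g x) (\<lambda>n r. tl r) (f x))" by (intro cpt_intros)
  moreover have "rec_nat ys (\<lambda>n r. tl r) k = drop k ys" for k and ys :: "'b list"
    by (induction k) (auto simp: drop_Suc tl_drop)
  ultimately show ?thesis by simp
qed

lemma cpt_take [cpt_intros]: "cpt f \<Longrightarrow> cpt g \<Longrightarrow> cpt (\<lambda>x. take (f x) (g x))"
proof -
  have "take k xs = rev (drop (length xs - k) (rev xs))" for k and xs :: "'b list"
    by (cases "k \<le> length xs") (simp_all add: rev_drop)
  then show "cpt f \<Longrightarrow> cpt g \<Longrightarrow> cpt (\<lambda>x. take (f x) (g x))" by (simp only:) (intro cpt_intros)
qed

lemma cpt_takeWhile [cpt_intros]: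
  assumes "cpt (\<lambda>p. g (fst p) (snd p))" "cpt f"
  shows "cpt (\<lambda>x. takeWhile (\<lambda>y. g x y) (f x))"
proof -
  have "cpt (\<lambda>x. foldr (\<lambda>y r. if g x y then y # r else []) (f x) [])"
    by (intro cpt_intros assms(2) cpt_comp2[OF assms(1)])
  moreover have "foldr (\<lambda>y r. if g x y then y # r else []) ys [] = takeWhile (g x) ys" for x ys
    by (induction ys) auto
  ultimately show ?thesis by simp
qed

lemma cpt_prod_decode [cpt_intros]: "cpt f \<Longrightarrow> cpt (\<lambda>x. prod_decode (f x))"
  by (rule cpt_comp[of prod_decode], rule cptI[of "\<lambda>n. n"]) (simp_all add: recfn_proj enc_prod_def)

lemma cpt_list_decode [cpt_intros]: "cpt f \<Longrightarrow> cpt (\<lambda>x. list_decode (f x))"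
proof (rule cpt_comp[of list_decode], rule cptI[of "\<lambda>n. n"])
  have "map (enc :: nat \<Rightarrow> nat) = id" by (simp add: fun_eq_iff map_idI)
  then show "enc n = enc (list_decode n)" for n by (simp add: enc_list_def)
qed (simp_all add: recfn_proj)

section \<open>The blocked simulation\<close>

text \<open>A list \<open>s\<close> of Booleans stands for a subset of the numbers below \<open>length s\<close>.
A history is the list of all releases \<open>(s, t)\<close> of a pattern \<open>s\<close> at stage \<open>t\<close>, the latest first;
the state of a random word is the last pattern released on it. In a state of length \<open>m\<close>
nothing beyond \<open>m\<close> has been enumerated, which is why only longer patterns may follow.\<close>

definition emitted :: "(bool list \<Rightarrow> nat list) \<Rightarrow> bool list \<Rightarrow> nat list" where
  "emitted M w = concat (map (\<lambda>i. M (take i w)) [0..<Suc (length w)])"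

definition profile :: "(bool list \<Rightarrow> nat list) \<Rightarrow> nat \<Rightarrow> bool list \<Rightarrow> bool list" where
  "profile M m w = map (\<lambda>j. j \<in> set (emitted M w)) [0..<m]"

definition supp :: "bool list \<Rightarrow> nat list" where
  "supp s = filter (\<lambda>j. s ! j) [0..<length s]"

text \<open>The latest release is at the head, so \<open>foldr\<close> applies the oldest one first.
  Each release inspects only as many bits as its stage, which keeps its effect fixed when the word
  grows.\<close>

definition state :: "(bool list \<Rightarrow> nat list) \<Rightarrow> (bool list \<times> nat) list \<Rightarrow> bool list \<Rightarrow> bool list" where
  "state M h w = foldr (\<lambda>p a. if length a < length (fst p)
      \<and> profile M (length (fst p)) (take (snd p) w) = fst p then fst p else a) h []"

definition movable :: "(bool list \<Rightarrow> nat list) \<Rightarrow> (bool list \<times> nat) list \<Rightarrow> bool list \<Rightarrow> bool list \<Rightarrow> bool" where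
  "movable M h s w \<longleftrightarrow> length (state M h w) < length s \<and> profile M (length s) w = s"

text \<open>The fraction of words of length \<open>t\<close> on which \<open>s\<close> can be
  released exceeds \<open>2 ^ -e\<close>, with denominators cleared so that the test stays within
  the natural numbers.\<close>

definition eligible :: "(bool list \<Rightarrow> nat list) \<Rightarrow> nat \<Rightarrow> nat \<Rightarrow> (bool list \<times> nat) list \<Rightarrow> bool list \<Rightarrow> bool" where
  "eligible M e t h s \<longleftrightarrow>
    2 ^ t < 2 ^ e * length (filter (\<lambda>w. movable M h s w) (List.n_lists t [False, True]))"

definition bits_of_nat :: "nat \<Rightarrow> bool list" where
  "bits_of_nat n = map (\<lambda>k. k \<noteq> 0) (list_decode n)"

text \<open>The order of the list acts as a priority: its head is released, so a pattern that
  remains eligible can be overtaken only from the finitely many smaller indices. Excluding patterns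
  of the history makes each overtake at most once.\<close>

definition candidates :: "(bool list \<Rightarrow> nat list) \<Rightarrow> nat \<Rightarrow> nat \<Rightarrow> (bool list \<times> nat) list \<Rightarrow> bool list list" where
  "candidates M e t h = filter (\<lambda>s. s \<notin> set (map (\<lambda>p. fst p) h) \<and> eligible M e t h s)
     (map (\<lambda>n. bits_of_nat n) [0..<t])"

definition answered :: "(bool list \<Rightarrow> nat \<Rightarrow> nat list) \<Rightarrow> nat \<Rightarrow> nat \<Rightarrow> bool list \<Rightarrow> bool" where
  "answered D L t s \<longleftrightarrow> (\<exists>l\<in>set [0..<Suc L]. \<exists>y\<in>set (List.n_lists l [False, True]).
     set (supp s) = set (concat (map (\<lambda>i. D y i) [0..<t])))"

text \<open>With an empty history no pattern is pending, so the first release does not wait for an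
  answer.\<close>

definition step :: "(bool list \<Rightarrow> nat list) \<Rightarrow> (bool list \<Rightarrow> nat \<Rightarrow> nat list) \<Rightarrow> nat \<Rightarrow> nat \<Rightarrow>
    nat \<Rightarrow> (bool list \<times> nat) list \<Rightarrow> (bool list \<times> nat) list" where
  "step M D e L t h =
    (if (case h of [] \<Rightarrow> True | p # _ \<Rightarrow> answered D L t (fst p))
     then (case candidates M e t h of [] \<Rightarrow> h | s # _ \<Rightarrow> (s, t) # h) else h)"

primrec history :: "(bool list \<Rightarrow> nat list) \<Rightarrow> (bool list \<Rightarrow> nat \<Rightarrow> nat list) \<Rightarrow> nat \<Rightarrow> nat \<Rightarrow>
    nat \<Rightarrow> (bool list \<times> nat) list" where
  "history M D e L 0 = []"
| "history M D e L (Suc t) = step M D e L t (history M D e L t)"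

definition binval :: "bool list \<Rightarrow> nat" where
  "binval bs = fold (\<lambda>b n. 2 * n + (if b then 1 else 0)) bs 0"

text \<open>The random bits start with \<open>1\<close> repeated \<open>l\<close> times, \<open>0\<close> and a word of length \<open>l\<close>
that describes the pair of \<open>e\<close> and \<open>L\<close>; this costs only logarithmically many bits. The bound \<open>L\<close>
is read and not computed from \<open>e\<close>, because \<open>\<alpha>\<close> need not be a computable number.\<close>

definition simulator :: "(bool list \<Rightarrow> nat list) \<Rightarrow> (bool list \<Rightarrow> nat \<Rightarrow> nat list) \<Rightarrow> bool list \<Rightarrow> nat list" where
  "simulator M D p =
    (let l = length (takeWhile (\<lambda>b. b) p);
         v = prod_decode (binval (take l (drop (Suc l) p)));
         q = drop (Suc (2 * l)) p
     in if length p < Suc (2 * l) then []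
        else supp (state M (history M D (fst v) (snd v) (length q)) q))"

section \<open>Computability of the simulator\<close>

lemma cpt_n_lists [cpt_intros]: "cpt f \<Longrightarrow> cpt (\<lambda>x. List.n_lists (f x) [False, True])"
proof -
  assume f: "cpt f"
  have "List.n_lists n [False, True] =
      rec_nat [[]] (\<lambda>_ r. concat (map (\<lambda>ys. [False # ys, True # ys]) r)) n" for n
    by (induction n) simp_all
  moreover have "cpt (\<lambda>x. rec_nat [[]] (\<lambda>_ r. concat (map (\<lambda>ys. [False # ys, True # ys]) r)) (f x))"
    by (intro cpt_intros f)
  ultimately show ?thesis by simp
qed

lemma cpt_supp [cpt_intros]: "cpt f \<Longrightarrow> cpt (\<lambda>x. supp (f x))"
proof -
  assume f: "cpt f"
  \<comment> \<open>Access with \<open>!\<close> beyond the end has no specified value, so the bit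
    is tested through a list of at most one entry, which is computable for every
    \<open>j\<close>.\<close>
  have "take 1 (drop j s) = [True] \<longleftrightarrow> s ! j" if "j < length s" for j and s :: "bool list"
    using that by (simp add: take_Suc_conv_app_nth hd_drop_conv_nth take_Suc)
  then have "supp = (\<lambda>s. filter (\<lambda>j. take 1 (drop j s) = [True]) [0..<length s])"
    unfolding supp_def by (intro ext filter_cong) auto
  moreover have "cpt (\<lambda>s. filter (\<lambda>j. take 1 (drop j s) = [True]) [0..<length s])"
    by (intro cpt_intros)
  ultimately show ?thesis using cpt_comp f by metis
qed

lemma cpt_bits_of_nat [cpt_intros]: "cpt f \<Longrightarrow> cpt (\<lambda>x. bits_of_nat (f x))"
  by (rule cpt_comp[where f = bits_of_nat]) (unfold bits_of_nat_def[abs_def], intro cpt_intros)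

lemma cpt_binval [cpt_intros]: "cpt f \<Longrightarrow> cpt (\<lambda>x. binval (f x))"
  by (rule cpt_comp[where f = binval]) (unfold binval_def[abs_def], intro cpt_intros)

context
  fixes M :: "bool list \<Rightarrow> nat list" and D :: "bool list \<Rightarrow> nat \<Rightarrow> nat list"
  assumes M: "cpt M" and D: "cpt (\<lambda>p. D (fst p) (snd p))"
begin

lemma cpt_emitted: "cpt f \<Longrightarrow> cpt (\<lambda>x. emitted M (f x))"
  by (rule cpt_comp[where f = "emitted M"]) (unfold emitted_def[abs_def], intro cpt_intros cpt_comp[OF M])

lemma cpt_profile: "cpt f \<Longrightarrow> cpt g \<Longrightarrow> cpt (\<lambda>x. profile M (f x) (g x))"
  by (rule cpt_comp2[where f = "profile M"]) (unfold profile_def, intro cpt_intros cpt_emitted)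

lemma cpt_state: "cpt f \<Longrightarrow> cpt g \<Longrightarrow> cpt (\<lambda>x. state M (f x) (g x))"
  by (rule cpt_comp2[where f = "state M"]) (unfold state_def, intro cpt_intros cpt_profile)

lemma cpt_movable: "cpt f \<Longrightarrow> cpt g \<Longrightarrow> cpt h \<Longrightarrow> cpt (\<lambda>x. movable M (f x) (g x) (h x))"
  by (rule cpt_comp3[where f = "movable M"]) (unfold movable_def, intro cpt_intros cpt_state cpt_profile)

lemma cpt_eligible:
  "cpt e \<Longrightarrow> cpt t \<Longrightarrow> cpt h \<Longrightarrow> cpt s \<Longrightarrow> cpt (\<lambda>x. eligible M (e x) (t x) (h x) (s x))"
proof -
  have "cpt (\<lambda>p. eligible M (fst p) (fst (snd p)) (fst (snd (snd p))) (snd (snd (snd p))))"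
    unfolding eligible_def by (intro cpt_intros cpt_movable)
  from cpt_comp3[where f = "\<lambda>e t p. eligible M e t (fst p) (snd p)", OF this]
  show "cpt e \<Longrightarrow> cpt t \<Longrightarrow> cpt h \<Longrightarrow> cpt s \<Longrightarrow> cpt (\<lambda>x. eligible M (e x) (t x) (h x) (s x))"
    using cpt_Pair by fastforce
qed

lemma cpt_candidates: "cpt e \<Longrightarrow> cpt t \<Longrightarrow> cpt h \<Longrightarrow> cpt (\<lambda>x. candidates M (e x) (t x) (h x))"
  by (rule cpt_comp3[where f = "candidates M"]) (unfold candidates_def, intro cpt_intros cpt_eligible)

lemma cpt_answered: "cpt e \<Longrightarrow> cpt t \<Longrightarrow> cpt h \<Longrightarrow> cpt (\<lambda>x. answered D (e x) (t x) (h x))"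
  by (rule cpt_comp3[where f = "answered D"]) (unfold answered_def, intro cpt_intros cpt_comp2[OF D])

lemma cpt_history: "cpt e \<Longrightarrow> cpt L \<Longrightarrow> cpt t \<Longrightarrow> cpt (\<lambda>x. history M D (e x) (L x) (t x))"
proof (rule cpt_comp3[where f = "history M D"])
  have "history M D e L t = rec_nat [] (\<lambda>t h. step M D e L t h) t" for e L t
    by (induction t) simp_all
  moreover have "cpt (\<lambda>p. rec_nat [] (\<lambda>t h. step M D (fst p) (fst (snd p)) t h) (snd (snd p)))"
    unfolding step_def by (intro cpt_intros cpt_candidates cpt_answered)
  ultimately show "cpt (\<lambda>p. history M D (fst p) (fst (snd p)) (snd (snd p)))" by simp
qed

lemma cpt_simulator: "cpt (simulator M D)"
  unfolding simulator_def[abs_def] Let_def by (intro cpt_intros cpt_state cpt_history)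

end

section \<open>Machines as computable maps on codes\<close>

lemma map_nonzero_nat_bool: "map (\<lambda>k. k \<noteq> 0) (map (enc :: bool \<Rightarrow> nat) xs) = xs"
  by (simp add: comp_def enc_bool_def map_idI)

lemma enc_nat_list: "enc (xs :: nat list) = list_encode xs"
  by (simp add: enc_list_def map_idI)

text \<open>A machine is required to behave on every number, also on lists with entries above 1,
  whereas \<open>cpt\<close> constrains only codes. Replacing each entry by its test for being
  nonzero first bridges the gap.\<close>

lemma prob_machine_iff_cpt: "prob_machine P \<longleftrightarrow> cpt P"
proof
  assume "prob_machine P"
  then show "cpt P" unfolding prob_machine_def computable_iff_recfn
    by (rule cptI) (simp only: enc_list_def[where 'a = bool] list_encode_inverse map_nonzero_nat_bool enc_nat_list)
next
  assume "cpt P"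
  then have "cpt (\<lambda>xs. P (map (\<lambda>k::nat. k \<noteq> 0) xs))" by (rule cpt_comp) (intro cpt_intros)
  then obtain F where F: "recfn 1 (\<lambda>xs. F (xs ! 0))"
    and "\<And>xs. F (list_encode xs) = list_encode (P (map (\<lambda>k::nat. k \<noteq> 0) xs))"
    unfolding cpt_def enc_nat_list by blast
  from this(2)[of "list_decode n" for n] F show "prob_machine P"
    unfolding prob_machine_def computable_iff_recfn by simp
qed

lemma det_machine_imp_cpt:
  assumes "det_machine E"
  shows "cpt (\<lambda>p. E (fst p) (snd p))"
proof (rule cptI)
  show "recfn 1 (\<lambda>xs. list_encode (E (map (\<lambda>k. k \<noteq> 0) (list_decode (fst (prod_decode (xs ! 0))))) (snd (prod_decode (xs ! 0)))))"
    using assms unfolding det_machine_def computable_iff_recfn .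
qed (simp only: enc_list_def[where 'a = bool] enc_prod_def prod_encode_inverse fst_conv snd_conv
  list_encode_inverse map_nonzero_nat_bool enc_nat_list enc_nat_def)

section \<open>Histories and states\<close>

lemma length_bits_prefix [simp]: "length (bits_prefix \<omega> n) = n"
  by (simp add: bits_prefix_def)

lemma take_bits_prefix: "t \<le> n \<Longrightarrow> take t (bits_prefix \<omega> n) = bits_prefix \<omega> t"
  by (simp add: bits_prefix_def take_map)

lemma drop_bits_prefix: "drop k (bits_prefix \<omega> n) = bits_prefix (\<lambda>i. \<omega> (i + k)) (n - k)"
  by (rule nth_equalityI) (simp_all add: bits_prefix_def add.commute)

lemma set_emitted: "set (emitted M (bits_prefix \<omega> n)) = (\<Union>i\<le>n. set (M (bits_prefix \<omega> i)))"
proof -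
  have "set (emitted M (bits_prefix \<omega> n)) = (\<Union>i\<in>{0..<Suc n}. set (M (take i (bits_prefix \<omega> n))))"
    unfolding emitted_def by (simp del: upt_Suc)
  also have "\<dots> = (\<Union>i\<le>n. set (M (bits_prefix \<omega> i)))"
    by (intro SUP_cong) (auto simp: take_bits_prefix)
  finally show ?thesis .
qed

text \<open>Holds for every \<open>M\<close>, monotone or not, since \<open>emitted\<close> collects
  the outputs on all prefixes.\<close>

lemma emitted_mono: "m \<le> n \<Longrightarrow> set (emitted M (bits_prefix \<omega> m)) \<subseteq> set (emitted M (bits_prefix \<omega> n))"
  unfolding set_emitted by (rule UN_mono) auto

lemma prob_enum_eq_emitted: "prob_enum M \<omega> = (\<Union>n. set (emitted M (bits_prefix \<omega> n)))"
  unfolding prob_enum_def set_emitted by auto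

lemma length_profile [simp]: "length (profile M m w) = m"
  by (simp add: profile_def)

lemma set_supp_map: "set (supp (map P [0..<m])) = {j. j < m \<and> P j}"
  by (auto simp: supp_def)

lemma set_supp_profile: "set (supp (profile M m w)) = set (emitted M w) \<inter> {..<m}"
  unfolding profile_def set_supp_map by auto

lemma set_words: "set (List.n_lists n [False, True]) = {w. length w = n}"
  by (auto simp: set_n_lists)

lemma length_filter_words:
  "length (filter P (List.n_lists n [False, True])) = card {w. length w = n \<and> P w}"
proof -
  have "set (filter P (List.n_lists n [False, True])) = {w. length w = n \<and> P w}"
    by (auto simp: set_words)
  then show ?thesis
    using distinct_card[OF distinct_filter[OF distinct_n_lists[of "[False, True]" n], of P]] by simp
qed

lemma answered_iff:
  "answered D L t s \<longleftrightarrow> (\<exists>y. length y \<le> L \<and> set (supp s) = (\<Union>i<t. set (D y i)))"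
  unfolding answered_def set_words by (auto simp: less_Suc_eq_le atLeast0LessThan Bex_def simp del: upt_Suc)

lemma bits_of_nat_list_encode: "bits_of_nat (list_encode (map (\<lambda>b. if b then 1 else 0) s)) = s"
  by (simp add: bits_of_nat_def comp_def map_idI)

declare history.simps(2) [simp del]

locale simulation =
  fixes M :: "bool list \<Rightarrow> nat list" and D :: "bool list \<Rightarrow> nat \<Rightarrow> nat list" and e L :: nat
begin

abbreviation "H \<equiv> history M D e L"

definition event :: "nat \<Rightarrow> bool list \<Rightarrow> bool" where
  "event t s \<longleftrightarrow> H (Suc t) = (s, t) # H t"

definition ready :: "nat \<Rightarrow> bool" where
  "ready t \<longleftrightarrow> (\<forall>s t' h. H t = (s, t') # h \<longrightarrow> answered D L t s)"

abbreviation state_at :: "(nat \<Rightarrow> bool) \<Rightarrow> nat \<Rightarrow> bool list" where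
  "state_at \<omega> t \<equiv> state M (H t) (bits_prefix \<omega> t)"

lemma history_Suc_cases:
  obtains (idle) "H (Suc t) = H t" "\<not> (ready t \<and> candidates M e t (H t) \<noteq> [])"
  | (act) s ss where "event t s" "ready t" "candidates M e t (H t) = s # ss"
proof (cases "ready t \<and> candidates M e t (H t) \<noteq> []")
  case True
  then obtain s ss where s: "candidates M e t (H t) = s # ss" by (cases "candidates M e t (H t)") auto
  have "event t s"
    using True s unfolding event_def ready_def by (auto simp: history.simps(2) step_def split: list.split)
  then show ?thesis using act True s by blast
next
  case False
  then have "H (Suc t) = H t"
    unfolding ready_def by (auto simp: history.simps(2) step_def split: list.split)
  then show ?thesis using idle False by blast
qed

lemma eventD:
  assumes "event t s"
  shows "ready t" "s \<notin> fst ` set (H t)" "eligible M e t (H t) s"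
proof -
  have "ready t \<and> s \<in> set (candidates M e t (H t))"
  proof (cases rule: history_Suc_cases[of t])
    case idle
    then show ?thesis using assms by (simp add: event_def)
  next
    case (act s' ss)
    then show ?thesis using assms by (simp add: event_def)
  qed
  then show "ready t" "s \<notin> fst ` set (H t)" "eligible M e t (H t) s"
    unfolding candidates_def by auto
qed

lemma history_eq_ConsD:
  assumes "H t = (s, t') # h"
  shows "t' < t \<and> event t' s \<and> H t' = h \<and> (\<forall>r. t' < r \<and> r \<le> t \<longrightarrow> H r = H t)"
  using assms
proof (induction t)
  case (Suc t)
  show ?case
  proof (cases rule: history_Suc_cases[of t])
    case idle
    then have IH: "t' < t" "event t' s" "H t' = h" "\<And>r. t' < r \<Longrightarrow> r \<le> t \<Longrightarrow> H r = H t"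
      using Suc.IH Suc.prems by metis+
    moreover have "H r = H (Suc t)" if "t' < r" "r \<le> Suc t" for r
      using IH(4)[of r] idle(1) that by (metis le_Suc_eq)
    ultimately show ?thesis by (metis less_SucI)
  next
    case (act s' ss)
    then have eq: "s' = s" "t' = t" "h = H t"
      using Suc.prems by (auto simp: event_def)
    moreover have "r = Suc t" if "t < r" "r \<le> Suc t" for r using that by simp
    ultimately show ?thesis using act(1) by (metis lessI)
  qed
qed simp

lemma history_mono: "m \<le> n \<Longrightarrow> set (H m) \<subseteq> set (H n)"
proof (induction rule: dec_induct)
  case (step n)
  then show ?case
    by (cases rule: history_Suc_cases[of n]) (auto simp: event_def)
qed simp

lemma history_idle:
  assumes "\<And>t s. m \<le> t \<Longrightarrow> t < n \<Longrightarrow> \<not> event t s" and "m \<le> n"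
  shows "H n = H m"
  using assms(2,1)
proof (induction rule: dec_induct)
  case (step n)
  then show ?case
    by (cases rule: history_Suc_cases[of n]) auto
qed simp

lemma in_historyD: "(s, t) \<in> set (H n) \<Longrightarrow> t < n \<and> event t s"
proof (induction n)
  case (Suc n)
  then show ?case
    by (cases rule: history_Suc_cases[of n]) (auto simp: event_def)
qed simp

lemma event_in_history: "event t s \<Longrightarrow> t < n \<Longrightarrow> (s, t) \<in> set (H n)"
  using history_mono[of "Suc t" n] by (auto simp: event_def)

text \<open>A released pattern stays in the history and is no candidate again, so the map from
  release times to patterns is injective.\<close>

lemma finite_event_times:
  assumes "finite Q"
  shows "finite {t. \<exists>s\<in>Q. event t s}"
proof (rule inj_on_finite[where f = "\<lambda>t. THE s. event t s", OF _ _ assms])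
  have the: "(THE s. event t s) = s" if "event t s" for t s
    using that by (intro the_equality) (auto simp: event_def)
  then show "(\<lambda>t. THE s. event t s) ` {t. \<exists>s\<in>Q. event t s} \<subseteq> Q" by auto
  have no: "\<not> event t' s" if "event t s" "t < t'" for t t' s
    using eventD(2)[of t' s] event_in_history[OF that] by force
  show "inj_on (\<lambda>t. THE s. event t s) {t. \<exists>s\<in>Q. event t s}"
  proof (rule inj_onI)
    fix t t'
    assume "t \<in> {t. \<exists>s\<in>Q. event t s}" "t' \<in> {t. \<exists>s\<in>Q. event t s}"
      and eq: "(THE s. event t s) = (THE s. event t' s)"
    then obtain s s' where s: "event t s" "event t' s'" by blast
    then have "s = s'" using eq the by simp
    then show "t = t'" using s no[of t s t'] no[of t' s t] by (cases t t' rule: linorder_cases) auto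
  qed
qed

text \<open>All releases in \<open>H t\<close> happened before stage \<open>t\<close> and inspect
  fewer than \<open>t\<close> bits.\<close>

lemma state_later:
  assumes "t \<le> n"
  shows "state M (H t) (bits_prefix \<omega> n) = state_at \<omega> t"
proof -
  have *: "take (snd p) (bits_prefix \<omega> n) = take (snd p) (bits_prefix \<omega> t)" if "p \<in> set (H t)" for p
    using in_historyD[of "fst p" "snd p" t] that assms by (simp add: take_bits_prefix)
  show ?thesis unfolding state_def
    by (rule foldr_cong) (simp_all add: *)
qed

lemma state_Suc:
  "state_at \<omega> (Suc t) = (if \<exists>s. event t s \<and> movable M (H t) s (bits_prefix \<omega> t)
     then THE s. event t s else state_at \<omega> t)"
proof (cases rule: history_Suc_cases[of t])
  case idle
  have "\<not> event t s" for s using idle by (simp add: event_def)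
  then show ?thesis using state_later[of t "Suc t"] idle by (simp)
next
  case (act s ss)
  then have H: "H (Suc t) = (s, t) # H t" by (simp add: event_def)
  have the: "(THE s. event t s) = s" and ev: "event t s' \<longleftrightarrow> s' = s" for s'
    using H by (auto simp: event_def)
  have "state_at \<omega> (Suc t) = (if length (state_at \<omega> t) < length s
      \<and> profile M (length s) (bits_prefix \<omega> t) = s then s else state_at \<omega> t)"
    using state_later[of t "Suc t" \<omega>] unfolding H
    by (simp add: state_def take_bits_prefix)
  then show ?thesis unfolding the ev movable_def by simp
qed

lemma state_move:
  assumes "event t s" "movable M (H t) s (bits_prefix \<omega> t)"
  shows "state_at \<omega> (Suc t) = s"
proof -
  have "(THE s. event t s) = s" using assms by (intro the_equality) (auto simp: event_def)
  moreover have "\<exists>s. event t s \<and> movable M (H t) s (bits_prefix \<omega> t)" using assms by blast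
  ultimately show ?thesis unfolding state_Suc by (simp only: if_True)
qed

lemma state_Suc_cases:
  obtains (stay) "state_at \<omega> (Suc t) = state_at \<omega> t"
  | (move) s where "event t s" "movable M (H t) s (bits_prefix \<omega> t)" "state_at \<omega> (Suc t) = s"
proof (cases "\<exists>s. event t s \<and> movable M (H t) s (bits_prefix \<omega> t)")
  case True
  then obtain s where s: "event t s" "movable M (H t) s (bits_prefix \<omega> t)" by blast
  show ?thesis by (rule move[OF s state_move[OF s]])
next
  case False
  show ?thesis using state_Suc[of t \<omega>] unfolding if_not_P[OF False] by (rule stay)
qed

text \<open>Soundness of the simulation: whatever is released on a sequence was emitted by
  \<open>M\<close> on a prefix of the same sequence.\<close>

lemma state_is_profile: "\<exists>r\<le>t. state_at \<omega> t = profile M (length (state_at \<omega> t)) (bits_prefix \<omega> r)"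
proof (induction t)
  case 0
  then show ?case by (simp add: state_def profile_def)
next
  case (Suc t)
  show ?case
  proof (cases rule: state_Suc_cases[of t \<omega>])
    case stay
    then show ?thesis using Suc by (metis le_Suc_eq)
  next
    case (move s)
    then show ?thesis by (metis movable_def le_Suc_eq order_refl)
  qed
qed

text \<open>The old pattern contains only numbers emitted earlier and below its length; the new one
  is longer and records everything emitted so far below its own length. Nothing already enumerated
  has to be taken back.\<close>

lemma state_supp_mono: "set (supp (state_at \<omega> t)) \<subseteq> set (supp (state_at \<omega> (Suc t)))"
proof (cases rule: state_Suc_cases[of t \<omega>])
  case (move s)
  obtain r where "r \<le> t" and r: "state_at \<omega> t = profile M (length (state_at \<omega> t)) (bits_prefix \<omega> r)"
    using state_is_profile by blast
  then have "set (supp (state_at \<omega> t)) \<subseteq> set (emitted M (bits_prefix \<omega> t)) \<inter> {..<length (state_at \<omega> t)}"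
    using set_supp_profile[of M "length (state_at \<omega> t)" "bits_prefix \<omega> r"] emitted_mono[of r t M \<omega>]
    by auto
  also have "\<dots> \<subseteq> set (supp (profile M (length s) (bits_prefix \<omega> t)))"
    using move unfolding set_supp_profile movable_def by auto
  finally show ?thesis using move by (simp add: movable_def)
qed simp

text \<open>Bounds the states at a given stage by finitely many patterns, uniformly in the random
  sequence.\<close>

lemma state_in_history: "state_at \<omega> t = [] \<or> state_at \<omega> t \<in> fst ` set (H t)"
proof (induction t)
  case (Suc t)
  show ?case
  proof (cases rule: state_Suc_cases[of t \<omega>])
    case stay
    then show ?thesis using Suc history_mono[of t "Suc t"] by auto
  next
    case (move s)
    then show ?thesis using event_in_history[of t s "Suc t"] by (force)
  qed
qed (simp add: state_def)

text \<open>The union also contains the output of stages before the last release; monotonicity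
  places it inside \<open>s\<close>.\<close>

lemma stuck_state:
  assumes "\<And>t. t0 < t \<Longrightarrow> H t = H (Suc t0)" and "event t0 s"
    and "movable M (H t0) s (bits_prefix \<omega> t0)"
  shows "(\<Union>t. set (supp (state_at \<omega> t))) = set (supp s)"
proof -
  have no: "\<not> event t s'" if "t0 < t" for t s'
    using assms(1)[of t] assms(1)[of "Suc t"] that by (simp add: event_def)
  have s: "state_at \<omega> (Suc (t0 + k)) = s" for k
  proof (induction k)
    case 0
    show ?case using state_move[OF assms(2,3)] by (simp)
  next
    case (Suc k)
    then show ?case
      using no[of "Suc (t0 + k)"] by (cases rule: state_Suc_cases[of "Suc (t0 + k)" \<omega>])
        auto
  qed
  have mono: "incseq (\<lambda>t. set (supp (state_at \<omega> t)))"
    by (rule incseq_SucI) (rule state_supp_mono)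
  have "set (supp (state_at \<omega> t)) \<subseteq> set (supp s)" for t
    using incseqD[OF mono, of t "Suc (t0 + t)"] s[of t] by simp
  moreover have "set (supp s) \<subseteq> (\<Union>t. set (supp (state_at \<omega> t)))"
    using s[of 0] by auto
  ultimately show ?thesis by blast
qed

end

section \<open>Coin tossing\<close>

interpretation coin: product_prob_space "\<lambda>_. measure_pmf (bernoulli_pmf (1/2))" "UNIV :: nat set"
  by unfold_locales

lemma space_coin [simp]: "space coin_space = UNIV"
  by (simp add: coin_space_def space_PiM)

lemma prob_space_coin: "prob_space coin_space"
  unfolding coin_space_def by unfold_locales

lemma bits_prefix_eq_iff: "bits_prefix \<omega> (length w) = w \<longleftrightarrow> (\<forall>i<length w. \<omega> i = w ! i)"
  unfolding bits_prefix_def list_eq_iff_nth_eq by simp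

lemma cylinder_eq_emb:
  "{\<omega>. bits_prefix \<omega> (length w) = w} = prod_emb UNIV (\<lambda>_. measure_pmf (bernoulli_pmf (1/2)))
     {..<length w} (\<Pi>\<^sub>E i\<in>{..<length w}. {w ! i})"
  unfolding bits_prefix_eq_iff prod_emb_def
  by (rule set_eqI) (simp only: mem_Collect_eq Int_iff vimage_eq PiE_iff restrict_extensional
      space_measure_pmf lessThan_iff restrict_apply singleton_iff UNIV_I extensional_UNIV simp_thms if_True Ball_def cong: imp_cong)

lemma cylinder_sets: "{\<omega>. bits_prefix \<omega> (length w) = w} \<in> sets coin_space"
  unfolding cylinder_eq_emb coin_space_def by (rule sets_PiM_I) auto

lemma measure_fair_coin: "measure (measure_pmf (bernoulli_pmf (1/2))) {b} = 1/2"
  unfolding measure_pmf_single by (cases b) simp_all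

lemma measure_cylinder: "measure coin_space {\<omega>. bits_prefix \<omega> (length w) = w} = 1 / 2 ^ length w"
  unfolding cylinder_eq_emb coin_space_def
  by (subst coin.measure_PiM_emb) (simp_all add: measure_fair_coin power_one_over)

lemma prefix_event_eq_Union:
  "{\<omega>. P (bits_prefix \<omega> n)} = (\<Union>w\<in>{w. length w = n \<and> P w}. {\<omega>. bits_prefix \<omega> n = w})"
  by auto

lemma finite_words: "finite {w :: bool list. length w = n \<and> P w}"
  by (rule finite_subset[OF _ finite_lists_length_eq[of UNIV n]]) auto

lemma prefix_event_sets: "{\<omega>. P (bits_prefix \<omega> n)} \<in> sets coin_space"
  unfolding prefix_event_eq_Union
proof (rule sets.finite_UN[OF finite_words])
  fix w assume "w \<in> {w. length w = n \<and> P w}"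
  then have "length w = n" by simp
  then show "{\<omega>. bits_prefix \<omega> n = w} \<in> sets coin_space" using cylinder_sets[of w] by simp
qed

text \<open>Translates the word count in \<open>eligible\<close> into a probability.\<close>

lemma measure_prefix_event:
  "measure coin_space {\<omega>. P (bits_prefix \<omega> n)} = card {w. length w = n \<and> P w} / 2 ^ n"
proof -
  interpret prob_space coin_space by (rule prob_space_coin)
  have "prob {\<omega>. P (bits_prefix \<omega> n)} =
      (\<Sum>w\<in>{w. length w = n \<and> P w}. prob {\<omega>. bits_prefix \<omega> n = w})"
    unfolding prefix_event_eq_Union[of P]
  proof (rule finite_measure_finite_Union[OF finite_words])
    show "(\<lambda>w. {\<omega>. bits_prefix \<omega> n = w}) ` {w. length w = n \<and> P w} \<subseteq> sets coin_space"
      by (rule image_subsetI) (rule prefix_event_sets)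
    show "disjoint_family_on (\<lambda>w. {\<omega>. bits_prefix \<omega> n = w}) {w. length w = n \<and> P w}"
      unfolding disjoint_family_on_def by blast
  qed
  also have "\<dots> = (\<Sum>w\<in>{w. length w = n \<and> P w}. 1 / 2 ^ n)"
  proof (rule sum.cong[OF refl])
    fix w assume "w \<in> {w. length w = n \<and> P w}"
    then have "length w = n" by simp
    then show "prob {\<omega>. bits_prefix \<omega> n = w} = 1 / 2 ^ n" using measure_cylinder[of w] by simp
  qed
  finally show ?thesis by simp
qed

lemma prob_enum_eq_sets: "{\<omega>. prob_enum P \<omega> = S} \<in> sets coin_space"
proof -
  have "{\<omega>. prob_enum P \<omega> = S} =
      (\<Inter>x. if x \<in> S then \<Union>n. {\<omega>. x \<in> set (P (bits_prefix \<omega> n))}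
           else \<Inter>n. {\<omega>. x \<notin> set (P (bits_prefix \<omega> n))})"
    unfolding prob_enum_def by (auto split: if_splits)
  also have "\<dots> \<in> sets coin_space"
    using sets.top[of coin_space]
    by (intro sets.countable_INT'') (auto intro!: sets.countable_UN sets.countable_INT'' prefix_event_sets)
  finally show ?thesis .
qed

lemma measure_ge_of_subset_Union:
  assumes "incseq A" "range A \<subseteq> sets coin_space" "c < measure coin_space (\<Union>n. A n)"
  shows "\<exists>N. \<forall>n\<ge>N. c < measure coin_space (A n)"
proof -
  interpret prob_space coin_space by (rule prob_space_coin)
  show ?thesis
    using order_tendstoD(1)[OF finite_Lim_measure_incseq[OF assms(2,1)] assms(3)]
    unfolding eventually_sequentially .
qed

text \<open>Each sequence in \<open>G\<close> emits the finite set \<open>S \<inter> {..<m}\<close>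
  within finitely many bits, so these events increase to \<open>G\<close>. Continuity from below
  yields a common stage, and the strict bound by \<open>c\<close> leaves room for the lost
  part.\<close>

lemma emitted_covers_eventually:
  assumes "G \<in> sets coin_space" "\<And>\<omega>. \<omega> \<in> G \<Longrightarrow> prob_enum M \<omega> = S" "c < measure coin_space G"
  shows "\<exists>N. \<forall>n\<ge>N. c < measure coin_space (G \<inter> {\<omega>. S \<inter> {..<m} \<subseteq> set (emitted M (bits_prefix \<omega> n))})"
proof (rule measure_ge_of_subset_Union)
  show "incseq (\<lambda>n. G \<inter> {\<omega>. S \<inter> {..<m} \<subseteq> set (emitted M (bits_prefix \<omega> n))})"
    by (intro incseq_SucI) (use emitted_mono[of n "Suc n" M for n] in force)
  show "range (\<lambda>n. G \<inter> {\<omega>. S \<inter> {..<m} \<subseteq> set (emitted M (bits_prefix \<omega> n))}) \<subseteq> sets coin_space"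
    using assms(1) prefix_event_sets by auto
  have "\<exists>n. S \<inter> {..<m} \<subseteq> set (emitted M (bits_prefix \<omega> n))" if "\<omega> \<in> G" for \<omega>
  proof -
    have "S \<inter> {..<m} \<subseteq> (\<Union>n. set (emitted M (bits_prefix \<omega> n)))"
      using assms(2)[OF that] unfolding prob_enum_eq_emitted by auto
    moreover have "\<exists>n. F \<subseteq> set (emitted M (bits_prefix \<omega> n))"
      if "finite F" "F \<subseteq> (\<Union>n. set (emitted M (bits_prefix \<omega> n)))" for F
      using that
    proof (induction F)
      case (insert x F)
      then obtain a b where "F \<subseteq> set (emitted M (bits_prefix \<omega> a))" "x \<in> set (emitted M (bits_prefix \<omega> b))"
        by auto
      then have "insert x F \<subseteq> set (emitted M (bits_prefix \<omega> (max a b)))"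
        using emitted_mono[of a "max a b" M \<omega>] emitted_mono[of b "max a b" M \<omega>] by auto
      then show ?case by blast
    qed simp
    ultimately show ?thesis by blast
  qed
  then have "(\<Union>n. G \<inter> {\<omega>. S \<inter> {..<m} \<subseteq> set (emitted M (bits_prefix \<omega> n))}) = G" by auto
  then show "c < measure coin_space (\<Union>n. G \<inter> {\<omega>. S \<inter> {..<m} \<subseteq> set (emitted M (bits_prefix \<omega> n))})"
    using assms(3) by simp
qed

section \<open>Enumerating a set of large probability\<close>

text \<open>\<open>stuck_answered\<close> is the form in which the hypothesis on finite sets enters,
  which separates the combinatorics of releases from complexities and constants.\<close>

locale covered_set = simulation +
  fixes S :: "nat set"
  assumes mass: "1 / 2 ^ e < prob_enum_exactly M S"
    and stuck_answered: "\<And>s t0. event t0 s \<Longrightarrow>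
      (\<And>t. t0 < t \<Longrightarrow> H t = H (Suc t0)) \<Longrightarrow>
      \<forall>\<^sub>F t in sequentially. answered D L t s"
begin

lemma candidates_nonempty_imp_event:
  assumes "candidates M e t (H t) \<noteq> []" "ready t"
  shows "\<exists>s. event t s"
  by (cases rule: history_Suc_cases[of t]) (use assms in auto)

text \<open>After a last release the pending pattern would eventually be answered (an empty history
  has none pending), and any candidate available then would be released.\<close>

lemma not_finite_events_if_candidates:
  assumes fin: "finite {t. \<exists>s. event t s}" and cand: "\<And>t. T \<le> t \<Longrightarrow> candidates M e t (H t) \<noteq> []"
  shows False
proof -
  from fin[unfolded finite_nat_set_iff_bounded] obtain U where "\<forall>t\<in>{t. \<exists>s. event t s}. t < U" ..
  then have U: "t < U" if "event t s" for t s using that by blast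
  have const: "H t = H U" if "U \<le> t" for t
    by (rule history_idle[OF _ that]) (use U leD in blast)
  have "\<exists>t\<ge>max T U. ready t"
  proof (cases "H U")
    case Nil
    then show ?thesis using const[of "max T U"] unfolding ready_def by (intro exI[of _ "max T U"]) auto
  next
    case (Cons p h)
    obtain s t0 where p: "p = (s, t0)" by fastforce
    have *: "t0 < U" "event t0 s" "\<And>r. t0 < r \<Longrightarrow> r \<le> U \<Longrightarrow> H r = H U"
      using history_eq_ConsD[OF Cons[unfolded p]] by blast+
    have "H t = H (Suc t0)" if "t0 < t" for t
    proof -
      have "H t = H U" using *(3)[of t, OF that] const[of t] by (rule linear[THEN disjE])
      also have "\<dots> = H (Suc t0)" using *(1) *(3)[of "Suc t0"] by simp
      finally show ?thesis .
    qed
    then have "\<forall>\<^sub>F t in sequentially. answered D L t s" using stuck_answered *(2) by blast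
    then obtain t where "t \<ge> max T U" "answered D L t s"
      using eventually_conj[OF _ eventually_ge_at_top[of "max T U"]] eventually_happens'[OF sequentially_bot]
      by blast
    then show ?thesis using const[of t] Cons p unfolding ready_def by auto
  qed
  then obtain t where "t \<ge> max T U" "ready t" by blast
  then obtain s where "event t s" using candidates_nonempty_imp_event[OF cand] by auto
  then show False using U \<open>t \<ge> max T U\<close> by force
qed

definition success :: "nat \<Rightarrow> nat \<Rightarrow> bool list \<Rightarrow> bool" where
  "success n t s \<longleftrightarrow> n \<le> t \<and> event t s \<and> set (supp s) \<subseteq> S \<and> S \<inter> {..<n} \<subseteq> set (supp s)"

lemma success_exists: "\<exists>t s. success n0 t s"
proof (rule ccontr)
  assume no: "\<nexists>t s. success n0 t s"
  \<comment> \<open>Patterns too short to show agreement with \<open>S\<close> below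
    \<open>n0\<close> are finitely many, so from some stage \<open>N0\<close> on none of them is
    released.\<close>
  have "finite {s :: bool list. length s < n0}"
    using finite_lists_length_le[of "UNIV :: bool set" n0] by (rule rev_finite_subset) auto
  from finite_event_times[OF this, unfolded finite_nat_set_iff_bounded]
  obtain N0 where "\<forall>t\<in>{t. \<exists>s\<in>{s. length s < n0}. event t s}. t < N0" ..
  then have N0: "t < N0" if "event t s" "length s < n0" for t s using that by blast
  define G where "G = {\<omega>. prob_enum M \<omega> = S}"
  have G: "G \<in> sets coin_space" "1 / 2 ^ e < measure coin_space G" "\<And>\<omega>. \<omega> \<in> G \<Longrightarrow> prob_enum M \<omega> = S"
    using mass prob_enum_eq_sets unfolding G_def prob_enum_exactly_def by auto
  obtain N where N: "\<And>n. n \<ge> N \<Longrightarrow>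
      1 / 2 ^ e < measure coin_space (G \<inter> {\<omega>. S \<inter> {..<n0} \<subseteq> set (emitted M (bits_prefix \<omega> n))})"
    using emitted_covers_eventually[OF G(1,3,2), of n0] by auto
  define n where "n = Max {N, N0, n0}"
  have n: "N \<le> n" "N0 \<le> n" "n0 \<le> n" unfolding n_def by auto
  define G' where "G' = G \<inter> {\<omega>. S \<inter> {..<n0} \<subseteq> set (emitted M (bits_prefix \<omega> n))}"
  have G': "G' \<in> sets coin_space" "1 / 2 ^ e < measure coin_space G'"
    using N[OF n(1)] G(1) prefix_event_sets unfolding G'_def by auto
  have emitted_S: "set (emitted M (bits_prefix \<omega> t)) \<subseteq> S" if "\<omega> \<in> G'" for \<omega> t
  proof -
    have "\<omega> \<in> G" using that by (simp add: G'_def)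
    from G(3)[OF this] show ?thesis unfolding prob_enum_eq_emitted by blast
  qed
  \<comment> \<open>A pattern matching a sequence of \<open>G'\<close> contains only elements of
    \<open>S\<close>; from stage \<open>n\<close> on it also contains all of those below
    \<open>n0\<close>. A move would thus be a success.\<close>
  have frozen: "state_at \<omega> t = state_at \<omega> n" if "\<omega> \<in> G'" "n \<le> t" for \<omega> t
    using that(2)
  proof (induction rule: dec_induct)
    case (step t)
    show ?case
    proof (cases rule: state_Suc_cases[of t \<omega>])
      case stay
      then show ?thesis using step by simp
    next
      case (move s)
      have "n0 \<le> length s" using N0[OF move(1)] n(2) step(1) by linarith
      have "set (supp s) = set (emitted M (bits_prefix \<omega> t)) \<inter> {..<length s}"
        using move(2) set_supp_profile[of M "length s" "bits_prefix \<omega> t"] unfolding movable_def by simp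
      moreover have "S \<inter> {..<n0} \<subseteq> set (emitted M (bits_prefix \<omega> t))"
        using that(1) emitted_mono[OF step(1), of M \<omega>] unfolding G'_def by auto
      ultimately have "success n0 t s"
        using move(1) n(3) step(1) emitted_S[OF that(1), of t] \<open>n0 \<le> length s\<close>
        unfolding success_def by auto
      then show ?thesis using no by blast
    qed
  qed simp
  \<comment> \<open>Longer than every pattern released before stage \<open>n\<close>, so that the
    initial segment of \<open>S\<close> of this length can replace any frozen state; above
    \<open>n0\<close>, so that its release would be a success.\<close>
  define c where "c = Suc (Max (insert n0 ((\<lambda>p. length (fst p)) ` set (H n))))"
  have c: "n0 < c" "\<And>p. p \<in> set (H n) \<Longrightarrow> length (fst p) < c"
    unfolding c_def by (auto simp: less_Suc_eq_le)
  have state_c: "length (state_at \<omega> n) < c" for \<omega>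
    using state_in_history[of n \<omega>] c by fastforce
  define s where "s = map (\<lambda>j. j \<in> S) [0..<c]"
  have s: "length s = c" "set (supp s) = S \<inter> {..<c}"
    unfolding s_def by (simp, subst set_supp_map, auto)
  have unused: "s \<notin> fst ` set (H t)" for t
  proof
    assume "s \<in> fst ` set (H t)"
    then obtain t' where t': "(s, t') \<in> set (H t)" by force
    then have ev': "event t' s" using in_historyD by blast
    show False
    proof (cases "t' < n")
      case True
      then show False using c(2) event_in_history[OF ev' True] s(1) by fastforce
    next
      case False
      moreover have "S \<inter> {..<n0} \<subseteq> S \<inter> {..<c}" using c(1) by auto
      ultimately have "success n0 t' s" unfolding success_def s(2) using ev' n(3) by simp
      then show False using no by blast
    qed
  qed
  obtain T where T: "\<And>t. t \<ge> T \<Longrightarrow>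
      1 / 2 ^ e < measure coin_space (G' \<inter> {\<omega>. S \<inter> {..<c} \<subseteq> set (emitted M (bits_prefix \<omega> t))})"
    using emitted_covers_eventually[OF G'(1) _ G'(2), of M S c] G(3) unfolding G'_def by auto
  have elig: "eligible M e t (H t) s" if "T \<le> t" "n \<le> t" for t
  proof -
    interpret prob_space coin_space by (rule prob_space_coin)
    have "movable M (H t) s (bits_prefix \<omega> t)"
      if "\<omega> \<in> G'" "S \<inter> {..<c} \<subseteq> set (emitted M (bits_prefix \<omega> t))" for \<omega>
    proof -
      have "profile M c (bits_prefix \<omega> t) = s"
        unfolding profile_def s_def using emitted_S[OF that(1), of t] that(2) by auto
      then show ?thesis using frozen[OF that(1) \<open>n \<le> t\<close>] state_c[of \<omega>] s(1)
        unfolding movable_def by simp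
    qed
    then have "G' \<inter> {\<omega>. S \<inter> {..<c} \<subseteq> set (emitted M (bits_prefix \<omega> t))}
        \<subseteq> {\<omega>. movable M (H t) s (bits_prefix \<omega> t)}" by auto
    from finite_measure_mono[OF this prefix_event_sets] T[OF \<open>T \<le> t\<close>]
    have "1 / 2 ^ e < prob {\<omega>. movable M (H t) s (bits_prefix \<omega> t)}" by linarith
    then have "(2::real) ^ t < 2 ^ e * card {w. length w = t \<and> movable M (H t) s w}"
      unfolding measure_prefix_event by (simp add: field_simps)
    then have "real (2 ^ t) < real (2 ^ e * card {w. length w = t \<and> movable M (H t) s w})" by simp
    then show ?thesis unfolding eligible_def length_filter_words of_nat_less_iff .
  qed
  define k where "k = list_encode (map (\<lambda>b. if b then 1 else 0) s)"
  have k: "bits_of_nat k = s" unfolding k_def by (rule bits_of_nat_list_encode)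
  define T' where "T' = Max {T, n, Suc k}"
  have T': "T \<le> T'" "n \<le> T'" "k < T'" unfolding T'_def by (auto simp: Suc_le_eq[symmetric])
  \<comment> \<open>The eligible pattern \<open>s\<close> sits at index \<open>k\<close>, so the
    head of the candidates always comes from an index at most \<open>k\<close>. Hence releases stop
    after finitely many, although a candidate is always waiting.\<close>
  have cand: "\<exists>s' ss. candidates M e t (H t) = s' # ss \<and> s' \<in> bits_of_nat ` {..k}" if "T' \<le> t" for t
  proof -
    define R where "R s \<longleftrightarrow> s \<notin> set (map (\<lambda>p. fst p) (H t)) \<and> eligible M e t (H t) s" for s
    define xs where "xs = filter R (map bits_of_nat [0..<Suc k])"
    have "[0..<t] = [0..<Suc k] @ [Suc k..<t]"
      using T'(3) that by (metis Suc_leI le_trans le_add_diff_inverse upt_add_eq_append zero_le)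
    then have "candidates M e t (H t) = xs @ filter R (map bits_of_nat [Suc k..<t])"
      unfolding candidates_def R_def xs_def by (simp del: upt_Suc)
    moreover have "R (bits_of_nat k)"
      using unused[of t] elig[of t] that T' unfolding k R_def by simp
    then have "bits_of_nat k \<in> set xs" unfolding xs_def by (auto simp del: upt_Suc)
    moreover have "set xs \<subseteq> bits_of_nat ` {..k}"
      unfolding xs_def by (auto simp: less_Suc_eq_le simp del: upt_Suc)
    ultimately show ?thesis by (cases xs) auto
  qed
  have "{t. \<exists>s. event t s} \<subseteq> {..<T'} \<union> {t. \<exists>s\<in>bits_of_nat ` {..k}. event t s}"
  proof
    fix t assume "t \<in> {t. \<exists>s. event t s}"
    then obtain s' where s': "event t s'" by blast
    show "t \<in> {..<T'} \<union> {t. \<exists>s\<in>bits_of_nat ` {..k}. event t s}"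
    proof (cases "t < T'")
      case False
      show ?thesis
      proof (cases rule: history_Suc_cases[of t])
        case idle
        then show ?thesis using s' by (simp add: event_def)
      next
        case (act s'' ss)
        then show ?thesis using cand[of t] False by auto
      qed
    qed simp
  qed
  then have "finite {t. \<exists>s. event t s}"
    by (rule finite_subset) (intro finite_UnI finite_event_times finite_imageI; simp)
  then show False using cand not_finite_events_if_candidates[of T'] by force
qed

text \<open>A success at stage t is followed by further successes. At the first release after t the
  history still ends with the pattern of t, and a release requires that this pattern has been
  answered.\<close>

lemma det_answer:
  "\<exists>y t. length y \<le> L \<and> n \<le> t \<and> (\<Union>i<t. set (D y i)) \<subseteq> S \<and> S \<inter> {..<n} \<subseteq> (\<Union>i<t. set (D y i))"
proof -
  obtain t s where s: "success n t s" using success_exists by blast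
  then have ev: "event t s" by (simp add: success_def)
  obtain t1 s1 where "success (Suc t) t1 s1" using success_exists by blast
  then have ex: "\<exists>s. t < t1 \<and> event t1 s" by (auto simp: success_def)
  define t' where "t' = (LEAST t'. \<exists>s. t < t' \<and> event t' s)"
  have t': "\<exists>s. t < t' \<and> event t' s" unfolding t'_def by (rule LeastI, rule ex)
  have "\<not> event r s'" if "Suc t \<le> r" "r < t'" for r s'
    using not_less_Least[of r "\<lambda>t'. \<exists>s. t < t' \<and> event t' s"] that unfolding t'_def by auto
  then have "H t' = H (Suc t)" using t' by (intro history_idle) auto
  then have "H t' = (s, t) # H t" using ev by (simp add: event_def)
  moreover have "ready t'" using t' eventD(1) by blast
  ultimately have "answered D L t' s" unfolding ready_def by blast
  then obtain y where "length y \<le> L" "set (supp s) = (\<Union>i<t'. set (D y i))"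
    unfolding answered_iff by blast
  then show ?thesis using s t' unfolding success_def by (intro exI[of _ y] exI[of _ t']) auto
qed

text \<open>Pigeonhole over the finitely many programs of length at most \<open>L\<close>:
  \<open>Q y n\<close> weakens as \<open>n\<close> decreases, so the largest of their failing
  indices would defeat them all. The demand \<open>t \<ge> n\<close> in \<open>Q\<close> covers
  every output step, which excludes numbers outside \<open>S\<close>.\<close>

lemma det_enum_exists: "\<exists>y. length y \<le> L \<and> det_enum D y = S"
proof -
  define Q where "Q y n \<longleftrightarrow> (\<exists>t\<ge>n. (\<Union>i<t. set (D y i)) \<subseteq> S \<and> S \<inter> {..<n} \<subseteq> (\<Union>i<t. set (D y i)))" for y n
  have Q_mono: "Q y m" if Q: "Q y n" and le: "m \<le> n" for y m n
  proof -
    obtain t where "t \<ge> n" "(\<Union>i<t. set (D y i)) \<subseteq> S" "S \<inter> {..<n} \<subseteq> (\<Union>i<t. set (D y i))"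
      using Q unfolding Q_def by blast
    moreover have "S \<inter> {..<m} \<subseteq> S \<inter> {..<n}" using le by auto
    ultimately have "m \<le> t \<and> (\<Union>i<t. set (D y i)) \<subseteq> S \<and> S \<inter> {..<m} \<subseteq> (\<Union>i<t. set (D y i))"
      using le by (meson order_trans)
    then show ?thesis unfolding Q_def by blast
  qed
  have "\<exists>y. length y \<le> L \<and> (\<forall>n. Q y n)"
  proof (rule ccontr)
    assume "\<nexists>y. length y \<le> L \<and> (\<forall>n. Q y n)"
    then have "\<forall>y. \<exists>n. length y \<le> L \<longrightarrow> \<not> Q y n" by blast
    from choice[OF this] obtain f where f: "\<And>y. length y \<le> L \<Longrightarrow> \<not> Q y (f y)" by blast
    have fin: "finite {y :: bool list. length y \<le> L}"
      using finite_lists_length_le[of "UNIV :: bool set" L] by simp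
    obtain y where y: "length y \<le> L" "Q y (Max (f ` {y. length y \<le> L}))"
      using det_answer[of "Max (f ` {y. length y \<le> L})"] unfolding Q_def by blast
    have "f y \<le> Max (f ` {y. length y \<le> L})" using fin y(1) by (intro Max_ge) simp_all
    then show False using f[OF y(1)] Q_mono[OF y(2)] by blast
  qed
  then obtain y where y: "length y \<le> L" "\<And>n. Q y n" by blast
  have "x \<in> S" if "x \<in> set (D y i)" for x i
  proof -
    obtain t where "Suc i \<le> t" "(\<Union>i<t. set (D y i)) \<subseteq> S" using y(2)[of "Suc i"] unfolding Q_def by blast
    moreover have "x \<in> (\<Union>i<t. set (D y i))" using that \<open>Suc i \<le> t\<close> by force
    ultimately show ?thesis by blast
  qed
  moreover have "x \<in> det_enum D y" if "x \<in> S" for x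
  proof -
    obtain t where "S \<inter> {..<Suc x} \<subseteq> (\<Union>i<t. set (D y i))" using y(2)[of "Suc x"] unfolding Q_def by blast
    moreover have "x \<in> S \<inter> {..<Suc x}" using that by simp
    ultimately show ?thesis unfolding det_enum_def by blast
  qed
  ultimately have "det_enum D y = S" unfolding det_enum_def by blast
  then show ?thesis using y(1) by blast
qed

end

section \<open>The probability of a stuck simulation\<close>

definition self_delimiting :: "bool list \<Rightarrow> bool list" where
  "self_delimiting b = replicate (length b) True @ False # b"

lemma length_self_delimiting [simp]: "length (self_delimiting b) = Suc (2 * length b)"
  by (simp add: self_delimiting_def)

lemma simulator_self_delimiting:
  assumes "binval b = prod_encode (e, L)"
  shows "simulator M D (self_delimiting b @ q) = supp (state M (history M D e L (length q)) q)"
proof -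
  have "takeWhile (\<lambda>b. b) (self_delimiting b @ q) = replicate (length b) True"
    by (simp add: self_delimiting_def takeWhile_append)
  moreover have "take (length b) (drop (Suc (length b)) (self_delimiting b @ q)) = b"
    "drop (Suc (2 * length b)) (self_delimiting b @ q) = q"
    by (simp_all add: self_delimiting_def)
  ultimately show ?thesis using assms by (simp add: simulator_def)
qed

text \<open>While only ones have been read, \<open>l\<close> is the number of bits read, so the test
  for an incomplete description succeeds as well.\<close>

lemma simulator_incomplete:
  assumes "n < Suc (2 * length b)"
  shows "simulator M D (take n (self_delimiting b)) = []"
proof -
  have "n < Suc (2 * length (takeWhile (\<lambda>b. b) (take n (self_delimiting b))))"
  proof (cases "n \<le> length b")
    case True
    then have "takeWhile (\<lambda>b. b) (take n (self_delimiting b)) = replicate n True"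
      by (simp add: self_delimiting_def)
    then show ?thesis by simp
  next
    case False
    then obtain m where "n - length b = Suc m" by (cases "n - length b") auto
    then have "takeWhile (\<lambda>b. b) (take n (self_delimiting b)) = replicate (length b) True"
      using False by (simp add: self_delimiting_def takeWhile_append)
    then show ?thesis using assms by simp
  qed
  then show ?thesis using assms by (simp add: simulator_def)
qed

lemma prob_enum_simulator:
  assumes b: "binval b = prod_encode (e, L)"
    and \<omega>: "bits_prefix \<omega> (Suc (2 * length b)) = self_delimiting b"
  shows "prob_enum (simulator M D) \<omega> =
    (\<Union>t. set (supp (state M (history M D e L t) (bits_prefix (\<lambda>i. \<omega> (i + Suc (2 * length b))) t))))"
proof -
  let ?k = "Suc (2 * length b)" and ?\<omega> = "\<lambda>i. \<omega> (i + Suc (2 * length b))"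
  have short: "simulator M D (bits_prefix \<omega> n) = []" if "n < ?k" for n
  proof -
    have "bits_prefix \<omega> n = take n (self_delimiting b)"
      using take_bits_prefix[of n ?k \<omega>] that \<omega> by simp
    then show ?thesis using simulator_incomplete that by simp
  qed
  have long: "simulator M D (bits_prefix \<omega> (t + ?k)) =
      supp (state M (history M D e L t) (bits_prefix ?\<omega> t))" for t
  proof -
    have "bits_prefix \<omega> (t + ?k) = self_delimiting b @ bits_prefix ?\<omega> t"
      using append_take_drop_id[of ?k "bits_prefix \<omega> (t + ?k)"] \<omega>
      unfolding drop_bits_prefix by (simp add: take_bits_prefix)
    then show ?thesis using simulator_self_delimiting[OF b, of M D "bits_prefix ?\<omega> t"] by simp
  qed
  have "prob_enum (simulator M D) \<omega> = (\<Union>t. set (simulator M D (bits_prefix \<omega> (t + ?k))))"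
  proof
    show "prob_enum (simulator M D) \<omega> \<subseteq> (\<Union>t. set (simulator M D (bits_prefix \<omega> (t + ?k))))"
    proof
      fix x assume "x \<in> prob_enum (simulator M D) \<omega>"
      then obtain n where n: "x \<in> set (simulator M D (bits_prefix \<omega> n))" unfolding prob_enum_def by blast
      then have "\<not> n < ?k" using short by fastforce
      then have "n = (n - ?k) + ?k" by simp
      then show "x \<in> (\<Union>t. set (simulator M D (bits_prefix \<omega> (t + ?k))))" using n by (metis UN_iff UNIV_I)
    qed
  qed (auto simp: prob_enum_def)
  then show ?thesis unfolding long .
qed

text \<open>Fixing the description costs \<open>Suc (2 * length b)\<close> bits. Among the following
  \<open>t0\<close> bits, eligibility supplies a fraction above \<open>2 ^ -e\<close> on which
  \<open>s\<close> is released and nothing is ever added.\<close>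

lemma (in simulation) stuck_probability:
  assumes b: "binval b = prod_encode (e, L)" and ev: "event t0 s"
    and stuck: "\<And>t. t0 < t \<Longrightarrow> H t = H (Suc t0)"
  shows "1 / 2 ^ (Suc (2 * length b) + e) < prob_enum_exactly (simulator M D) (set (supp s))"
proof -
  interpret prob_space coin_space by (rule prob_space_coin)
  let ?k = "Suc (2 * length b)" and ?W = "{w. length w = t0 \<and> movable M (H t0) s w}"
  define P where "P u \<longleftrightarrow> take ?k u = self_delimiting b \<and> movable M (H t0) s (drop ?k u)" for u
  have "{\<omega>. P (bits_prefix \<omega> (?k + t0))} \<subseteq> {\<omega>. prob_enum (simulator M D) \<omega> = set (supp s)}"
  proof clarify
    fix \<omega> assume "P (bits_prefix \<omega> (?k + t0))"
    then have "bits_prefix \<omega> ?k = self_delimiting b"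
      and "movable M (H t0) s (bits_prefix (\<lambda>i. \<omega> (i + ?k)) t0)"
      unfolding P_def by (simp_all add: take_bits_prefix drop_bits_prefix)
    then show "prob_enum (simulator M D) \<omega> = set (supp s)"
      using prob_enum_simulator[OF b] stuck_state[OF stuck ev] by simp
  qed
  from finite_measure_mono[OF this prob_enum_eq_sets]
  have "card {u. length u = ?k + t0 \<and> P u} / 2 ^ (?k + t0) \<le> prob_enum_exactly (simulator M D) (set (supp s))"
    unfolding measure_prefix_event prob_enum_exactly_def .
  moreover have "card ?W \<le> card {u. length u = ?k + t0 \<and> P u}"
  proof (rule card_inj_on_le)
    show "inj_on (\<lambda>w. self_delimiting b @ w) ?W" by (simp add: inj_on_def)
    show "(\<lambda>w. self_delimiting b @ w) ` ?W \<subseteq> {u. length u = ?k + t0 \<and> P u}"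
      by (auto simp: P_def)
  qed (rule finite_words)
  moreover have "1 / 2 ^ (?k + e) < real (card ?W) / 2 ^ (?k + t0)"
  proof -
    have "2 ^ t0 < 2 ^ e * card ?W"
      using eventD(3)[OF ev] unfolding eligible_def length_filter_words .
    then have "real (2 ^ t0) < real (2 ^ e * card ?W)" by (simp only: of_nat_less_iff)
    then show ?thesis by (simp add: field_simps power_add)
  qed
  ultimately show ?thesis
    by (smt (verit) divide_right_mono of_nat_le_iff zero_le_power)
qed

section \<open>Short binary descriptions of the parameters\<close>

lemma binval_append_bit: "binval (bs @ [x]) = 2 * binval bs + (if x then 1 else 0)"
  by (simp add: binval_def)

text \<open>Binary expansion without leading zeros; the summand 1 accounts for zero, which is
  described by the empty word.\<close>

lemma binval_surj: "\<exists>bs. binval bs = n \<and> 2 ^ length bs \<le> 2 * n + 1"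
proof -
  have "\<exists>bs. binval bs = n \<and> 2 ^ length bs \<le> 2 * n" if "0 < n" for n
    using that
  proof (induction n rule: less_induct)
    case (less n)
    show ?case
    proof (cases "n = 1")
      case True
      then show ?thesis by (intro exI[of _ "[True]"]) (simp add: binval_def)
    next
      case False
      then have "0 < n div 2" "n div 2 < n" using less.prems by auto
      then obtain bs where "binval bs = n div 2" "2 ^ length bs \<le> 2 * (n div 2)"
        using less.IH by blast
      then show ?thesis
        by (intro exI[of _ "bs @ [odd n]"]) (auto simp: binval_append_bit)
    qed
  qed
  from this[of n] show ?thesis
    by (cases "n = 0") (auto intro: exI[of _ "[]"] simp: binval_def)
qed

text \<open>A polynomial bound is enough to make the description of a pair logarithmic in its
  entries.\<close>

lemma prod_encode_le: "prod_encode (m, n) \<le> (m + n + 1)\<^sup>2"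
proof -
  have "triangle k \<le> k * k + k" for k by (induction k) auto
  from this[of "m + n"] show ?thesis by (simp add: prod_encode_def power2_eq_square)
qed

section \<open>Choice of the parameters\<close>

lemma log2_le_self:
  fixes y :: real
  assumes "0 < y"
  shows "log 2 y \<le> y"
proof -
  define n where "n = nat \<lfloor>y\<rfloor>"
  have n: "real n \<le> y" "y \<le> real (Suc n)" using assms unfolding n_def by linarith+
  have "Suc n \<le> 2 ^ n" by (simp add: Suc_le_eq)
  then have "real (Suc n) \<le> 2 ^ n" by (metis of_nat_le_iff of_nat_numeral of_nat_power)
  also have "\<dots> = 2 powr real n" by (simp add: powr_realpow)
  also have "\<dots> \<le> 2 powr y" using n by simp
  finally have "y \<le> 2 powr y" using n by linarith
  then show ?thesis using assms by (simp add: log_le_iff)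
qed

text \<open>The word \<open>b\<close> describes \<open>L\<close>, yet its length enters the bound
  that \<open>L\<close> must dominate. That length is at most \<open>2 + 2 * A + 2 * g\<close>,
  where \<open>g\<close> is the logarithm of \<open>h + 2\<close> and \<open>A\<close> is
  logarithmic in \<open>K\<close>, so it remains to let \<open>K\<close> outgrow a multiple of
  \<open>A\<close>.\<close>

lemma parameters_exist:
  fixes \<alpha> C c :: real
  assumes "\<alpha> \<ge> 1"
  shows "\<exists>C'. \<forall>h\<ge>0. \<exists>e L b. binval b = prod_encode (e, L) \<and> h < real e
    \<and> (\<forall>x. 0 \<le> x \<and> x \<le> real (Suc (2 * length b) + e) + c \<longrightarrow> \<alpha> * x + C * log 2 (x + 2) + C \<le> real L)
    \<and> real L \<le> \<alpha> * h + C' * log 2 (h + 2) + C'"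
proof -
  define d where "d = \<bar>c\<bar>"
  define E where "E = \<bar>C\<bar>"
  \<comment> \<open>\<open>B * A + a\<close> collects the terms free of \<open>h\<close> and
    \<open>g\<close> in the final estimate; the last summand 1 pays for rounding \<open>L\<close>
    down.\<close>
  define a where "a = \<alpha> * (6 + d) + E * (12 + d) + 1"
  define B where "B = 4 * \<alpha> + 4 * E"
  \<comment> \<open>Required is \<open>B * A + a \<le> K\<close>, where \<open>A\<close> depends on
    \<open>K\<close>. With \<open>1 + \<alpha> + 2 * K\<close> written as the square of
    \<open>r\<close>, \<open>A\<close> is at most \<open>2 * r\<close>, and it suffices that this
    square is at least \<open>4 * B * r + 2 * a + 1 + \<alpha>\<close>; this \<open>r\<close>
    achieves it, being at least 1.\<close>
  define r where "r = 4 * B + 2 * a + 1 + \<alpha>"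
  define K where "K = (r\<^sup>2 - 1 - \<alpha>) / 2"
  define A where "A = log 2 (1 + \<alpha> + 2 * K)"
  have aB: "0 \<le> a" "0 \<le> B" "4 * \<alpha> + E \<le> B" using assms unfolding a_def B_def d_def E_def by auto
  then have r: "1 \<le> r" using assms unfolding r_def by linarith
  have "1 + \<alpha> + 2 * K = r\<^sup>2" unfolding K_def by (simp add: field_simps)
  then have "A = 2 * log 2 r" using r unfolding A_def by (simp add: log_nat_power)
  also have "\<dots> \<le> 2 * r" using log2_le_self[of r] r by simp
  finally have "B * A \<le> B * (2 * r)" using aB by (intro mult_left_mono) auto
  moreover have "(2 * a + 1 + \<alpha>) * 1 \<le> (2 * a + 1 + \<alpha>) * r"
    using r aB assms by (intro mult_left_mono) auto
  moreover have "r\<^sup>2 = 4 * B * r + (2 * a + 1 + \<alpha>) * r"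
    by (subst power2_eq_square, subst (1) r_def) (simp add: algebra_simps)
  ultimately have "B * A + a \<le> K" and "2 * (B * r) \<le> K" unfolding K_def using aB by (simp_all add: field_simps)
  moreover have "B * 1 \<le> B * r" using r aB by (intro mult_left_mono) auto
  ultimately have K: "4 * \<alpha> + E \<le> K" and K2: "\<alpha> * (4 * A + 6 + d) + E * (12 + 4 * A + d) + 1 \<le> K"
    using aB unfolding a_def B_def by (simp_all add: algebra_simps)
  have pos: "0 \<le> d" "0 \<le> E" "0 < K" using K assms by (simp_all add: d_def E_def)
  have "0 \<le> A" unfolding A_def using pos assms by simp
  show ?thesis
  proof (intro exI[of _ K] allI impI)
    fix h :: real assume h: "0 \<le> h"
    define g where "g = log 2 (h + 2)"
    have g: "1 \<le> g" "g \<le> h + 2" using h log2_le_self[of "h + 2"] unfolding g_def by simp_all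
    \<comment> \<open>Strictly above \<open>h\<close>, since the threshold \<open>2 ^ -e\<close>
      must lie strictly below the probability of \<open>S\<close>.\<close>
    define e where "e = Suc (nat \<lfloor>h\<rfloor>)"
    have e: "h < real e" "real e \<le> h + 1" using h unfolding e_def by linarith+
    define L where "L = nat \<lfloor>\<alpha> * h + K * g + K\<rfloor>"
    have "0 \<le> \<alpha> * h + K * g + K" using assms h pos g by simp
    then have L: "real L \<le> \<alpha> * h + K * g + K" "\<alpha> * h + K * g + K - 1 \<le> real L"
      unfolding L_def by linarith+
    obtain b where b: "binval b = prod_encode (e, L)" "2 ^ length b \<le> 2 * prod_encode (e, L) + 1"
      using binval_surj by blast
    have "(2::nat) ^ length b \<le> (2 * (e + L + 1))\<^sup>2"
      using b(2) prod_encode_le[of e L] by (simp add: power2_eq_square algebra_simps)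
    then have "real (2 ^ length b) \<le> real ((2 * (e + L + 1))\<^sup>2)" by (rule of_nat_mono)
    then have "2 ^ length b \<le> (2 * (real e + real L + 1))\<^sup>2"
      by (simp only: of_nat_power of_nat_mult of_nat_add of_nat_numeral of_nat_1)
    moreover have "real e + real L + 1 \<le> (1 + \<alpha> + 2 * K) * (h + 2)"
    proof -
      have "K * g \<le> K * (h + 2)" using g pos by (intro mult_left_mono) auto
      moreover have "K * 1 \<le> K * (h + 2)" using h pos by (intro mult_left_mono) auto
      moreover have "(1 + \<alpha> + 2 * K) * (h + 2) = h + 2 + \<alpha> * h + 2 * \<alpha> + K * (h + 2) + K * (h + 2)"
        by (simp add: algebra_simps)
      ultimately show ?thesis using e L assms by linarith
    qed
    then have "(2 * (real e + real L + 1))\<^sup>2 \<le> (2 * ((1 + \<alpha> + 2 * K) * (h + 2)))\<^sup>2"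
      by (intro power_mono mult_left_mono) auto
    ultimately have "2 ^ length b \<le> (2 * ((1 + \<alpha> + 2 * K) * (h + 2)))\<^sup>2" by (rule order_trans)
    then have "log 2 (2 ^ length b) \<le> log 2 ((2 * ((1 + \<alpha> + 2 * K) * (h + 2)))\<^sup>2)"
      by (intro log_mono) auto
    also have "\<dots> = 2 * (1 + (A + g))"
      using assms pos h unfolding A_def g_def
      by (subst log_nat_power) (simp_all add: log_mult)
    finally have len: "real (length b) \<le> 2 + 2 * A + 2 * g" by (simp add: log_nat_power)
    have "\<alpha> * x + C * log 2 (x + 2) + C \<le> real L"
      if x: "0 \<le> x" "x \<le> real (Suc (2 * length b) + e) + c" for x
    proof -
      have x': "x \<le> h + 4 * g + 4 * A + 6 + d" using x(2) len e unfolding d_def by simp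
      have "x + 2 \<le> (h + 2) + 4 * (h + 2) + (4 * A + 6 + d) * 1" using x' g by simp
      also have "\<dots> \<le> (h + 2) + 4 * (h + 2) + (4 * A + 6 + d) * (h + 2)"
        using h \<open>0 \<le> A\<close> pos by (intro add_left_mono mult_left_mono) auto
      finally have "x + 2 \<le> (h + 2) * (11 + 4 * A + d)" by (simp add: algebra_simps)
      then have "log 2 (x + 2) \<le> log 2 ((h + 2) * (11 + 4 * A + d))"
        using x by (intro log_mono) auto
      also have "\<dots> = g + log 2 (11 + 4 * A + d)"
        using h \<open>0 \<le> A\<close> pos unfolding g_def by (subst log_mult) auto
      also have "\<dots> \<le> g + (11 + 4 * A + d)" using log2_le_self[of "11 + 4 * A + d"] \<open>0 \<le> A\<close> pos by simp
      finally have lx: "log 2 (x + 2) \<le> g + (11 + 4 * A + d)" .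
      have "C * log 2 (x + 2) \<le> E * log 2 (x + 2)"
        using x unfolding E_def by (intro mult_right_mono) auto
      also have "\<dots> \<le> E * (g + (11 + 4 * A + d))" using lx pos by (intro mult_left_mono) auto
      finally have "C * log 2 (x + 2) \<le> E * (g + (11 + 4 * A + d))" .
      moreover have "\<alpha> * x \<le> \<alpha> * (h + 4 * g + 4 * A + 6 + d)" using x' assms by (intro mult_left_mono) auto
      moreover have "C \<le> E" unfolding E_def by simp
      moreover have "(4 * \<alpha> + E) * g \<le> K * g" using K g by (intro mult_right_mono) auto
      ultimately show ?thesis using K2 L(2) by (simp add: algebra_simps)
    qed
    then show "\<exists>e L b. binval b = prod_encode (e, L) \<and> h < real e
      \<and> (\<forall>x. 0 \<le> x \<and> x \<le> real (Suc (2 * length b) + e) + c \<longrightarrow> \<alpha> * x + C * log 2 (x + 2) + C \<le> real L)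
      \<and> real L \<le> \<alpha> * h + K * log 2 (h + 2) + K"
      using b(1) e(1) L(1) unfolding g_def by blast
  qed
qed

section \<open>From finite sets to all sets\<close>

lemma I_D_le_imp_program:
  assumes "I_D D S \<le> enat L"
  shows "\<exists>y. length y \<le> L \<and> det_enum D y = S"
proof (rule ccontr)
  assume "\<nexists>y. length y \<le> L \<and> det_enum D y = S"
  then have "enat (Suc L) \<le> I_D D S"
    unfolding I_D_def by (intro INF_greatest) (auto simp: not_le Suc_le_eq)
  with assms have "enat (Suc L) \<le> enat L" by (rule order_trans[rotated])
  then show False by simp
qed

text \<open>From some stage on, all elements of the finite set have been output, and the program
  never outputs any other number.\<close>

lemma eventually_answered:
  assumes "length y \<le> L" "det_enum D y = set (supp s)"
  shows "\<forall>\<^sub>F t in sequentially. answered D L t s"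
proof -
  have "\<exists>T. \<forall>t\<ge>T. F \<subseteq> (\<Union>i<t. set (D y i))" if "finite F" "F \<subseteq> det_enum D y" for F
    using that
  proof (induction F)
    case (insert x F)
    then obtain T i where T: "\<And>t. t \<ge> T \<Longrightarrow> F \<subseteq> (\<Union>i<t. set (D y i))" and i: "x \<in> set (D y i)"
      unfolding det_enum_def by auto
    have "insert x F \<subseteq> (\<Union>i<t. set (D y i))" if "t \<ge> max T (Suc i)" for t
      using T[of t] i that by (force simp: Suc_le_eq)
    then show ?case by blast
  qed simp
  from this[of "set (supp s)"] obtain T where "\<And>t. t \<ge> T \<Longrightarrow> set (supp s) \<subseteq> (\<Union>i<t. set (D y i))"
    using assms(2) by auto
  moreover have "(\<Union>i<t. set (D y i)) \<subseteq> set (supp s)" for t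
    unfolding assms(2)[symmetric] det_enum_def by blast
  ultimately show ?thesis
    unfolding answered_iff eventually_sequentially using assms(1) by (meson subset_antisym)
qed

lemma prob_enum_exactly_le_1: "prob_enum_exactly M S \<le> 1"
  unfolding prob_enum_exactly_def by (rule prob_space.prob_le_1[OF prob_space_coin])

lemma prob_enum_exactly_nonneg: "0 \<le> prob_enum_exactly M S"
  unfolding prob_enum_exactly_def by simp

lemma H_M_eq_erealD:
  assumes "H_M M S = ereal h"
  shows "0 \<le> h" "prob_enum_exactly M S = 2 powr - h"
proof -
  have p: "prob_enum_exactly M S \<noteq> 0" "h = - log 2 (prob_enum_exactly M S)"
    using assms unfolding H_M_def by (auto split: if_splits)
  then have "0 < prob_enum_exactly M S" using prob_enum_exactly_nonneg[of M S] by linarith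
  then show "0 \<le> h" "prob_enum_exactly M S = 2 powr - h"
    using p(2) prob_enum_exactly_le_1[of M S] by (simp_all add: powr_minus_divide)
qed

lemma H_M_bounded:
  assumes "1 / 2 ^ n < prob_enum_exactly M S"
  shows "H_M M S \<le> ereal (real n)"
proof -
  have pos: "0 < prob_enum_exactly M S" using assms by (rule order_less_trans[rotated]) simp
  have "log 2 (1 / 2 ^ n) < log 2 (prob_enum_exactly M S)" using assms pos by (simp add: log_less)
  then show ?thesis using pos by (simp add: H_M_def log_divide log_nat_power)
qed

theorem theorem3:
  fixes D0 :: "bool list \<Rightarrow> nat \<Rightarrow> nat list"
    and M0 :: "bool list \<Rightarrow> nat list"
    and \<alpha> C :: real
  assumes "universal_det D0"
    and "optimal_prob M0"
    and "\<alpha> \<ge> 1"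
    and "\<forall>S h. finite S \<longrightarrow> H_M M0 S = ereal h \<longrightarrow>
           ereal_of_enat (I_D D0 S) \<le> ereal (\<alpha> * h + C * log 2 (h + 2) + C)"
  shows "\<exists>C'::real. \<forall>S h. H_M M0 S = ereal h \<longrightarrow>
           ereal_of_enat (I_D D0 S) \<le> ereal (\<alpha> * h + C' * log 2 (h + 2) + C')"
proof -
  \<comment> \<open>A single machine serves all \<open>e\<close> and \<open>L\<close>, because it
    reads them from its random bits; hence one optimality constant \<open>c\<close> covers all
    sets.\<close>
  have "prob_machine (simulator M0 D0)"
    using assms(1,2) unfolding universal_det_def optimal_prob_def prob_machine_iff_cpt
    by (intro cpt_simulator det_machine_imp_cpt) auto
  then obtain c where c: "\<And>S. H_M M0 S \<le> H_M (simulator M0 D0) S + ereal c"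
    using assms(2) unfolding optimal_prob_def by blast
  obtain C' where C': "\<And>h. 0 \<le> h \<Longrightarrow> \<exists>e L b. binval b = prod_encode (e, L) \<and> h < real e
    \<and> (\<forall>x. 0 \<le> x \<and> x \<le> real (Suc (2 * length b) + e) + c \<longrightarrow> \<alpha> * x + C * log 2 (x + 2) + C \<le> real L)
    \<and> real L \<le> \<alpha> * h + C' * log 2 (h + 2) + C'"
    using parameters_exist[OF assms(3), of c C] by blast
  have "ereal_of_enat (I_D D0 S) \<le> ereal (\<alpha> * h + C' * log 2 (h + 2) + C')"
    if h: "H_M M0 S = ereal h" for S h
  proof -
    obtain e L b where b: "binval b = prod_encode (e, L)" and e: "h < real e"
      and x: "\<And>x. 0 \<le> x \<Longrightarrow> x \<le> real (Suc (2 * length b) + e) + c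
          \<Longrightarrow> \<alpha> * x + C * log 2 (x + 2) + C \<le> real L"
      and L: "real L \<le> \<alpha> * h + C' * log 2 (h + 2) + C'"
      using C'[OF H_M_eq_erealD(1)[OF h]] by blast
    interpret covered_set M0 D0 e L S
    proof
      have "2 powr - real e < 2 powr - h" using e by simp
      then show "1 / 2 ^ e < prob_enum_exactly M0 S"
        unfolding H_M_eq_erealD(2)[OF h] by (simp add: powr_minus_divide powr_realpow)
    next
      fix s t0
      assume "simulation.event M0 D0 e L t0 s"
        and "\<And>t. t0 < t \<Longrightarrow> history M0 D0 e L t = history M0 D0 e L (Suc t0)"
      from simulation.stuck_probability[OF b this]
      have "H_M (simulator M0 D0) (set (supp s)) \<le> ereal (real (Suc (2 * length b) + e))"
        by (rule H_M_bounded)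
      then have le: "H_M M0 (set (supp s)) \<le> ereal (real (Suc (2 * length b) + e) + c)"
        using order_trans[OF c add_right_mono] by fastforce
      \<comment> \<open>The upper bound makes the value finite, so the hypothesis on finite sets
        applies; the same bound puts \<open>h'\<close> into the range that \<open>L\<close> was
        chosen for.\<close>
      obtain h' where h': "H_M M0 (set (supp s)) = ereal h'"
        using le unfolding H_M_def by (auto split: if_splits)
      have "ereal_of_enat (I_D D0 (set (supp s))) \<le> ereal (\<alpha> * h' + C * log 2 (h' + 2) + C)"
        using assms(4) h' by blast
      also have "\<dots> \<le> ereal (real L)"
        using x[of h'] H_M_eq_erealD(1)[OF h'] le h' by simp
      finally have "ereal_of_enat (I_D D0 (set (supp s))) \<le> ereal_of_enat (enat L)" by simp
      then have "I_D D0 (set (supp s)) \<le> enat L" by (simp only: ereal_of_enat_le_iff)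
      then show "\<forall>\<^sub>F t in sequentially. answered D0 L t s"
        using I_D_le_imp_program eventually_answered by blast
    qed
    obtain y where y: "length y \<le> L" "det_enum D0 y = S" using det_enum_exists by blast
    then have "I_D D0 S \<le> enat (length y)" unfolding I_D_def by (intro INF_lower) simp
    then have "I_D D0 S \<le> enat L" using y(1) order_trans by fastforce
    then have "ereal_of_enat (I_D D0 S) \<le> ereal_of_enat (enat L)" by (simp only: ereal_of_enat_le_iff)
    also have "\<dots> \<le> ereal (\<alpha> * h + C' * log 2 (h + 2) + C')" using L by simp
    finally show ?thesis .
  qed
  then show ?thesis by blast
qed

end
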